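(* Let $\mathbb{K}$ be a field of characteristic zero. The collection $\mathcal{H}$ of sequences $(h_1,\dots,h_{\lfloor d/2\rfloor})$, where the $h_i$ are entries of Hilbert functions $(h_0,h_1,\dots,h_d)$ of (flag) simplicial Perazzo algebras of socle degree $d$ over $\mathbb{K}$, is unconstrained for every $d$. In particular, the first half of Hilbert functions of Perazzo algebras is an unconstrained collection of sequences.
   Context: Here $d$ denotes a positive integer. A collection $\mathcal{H}$ of sequences of length $q$ is unconstrained if for every permutation $\pi$ of $\{1,\dots,q\}$ there is a sequence $(a_1,\dots,a_q)\in\mathcal{H}$ with $a_{\pi(1)}<a_{\pi(2)}<\dots<a_{\pi(q)}$. A Perazzo form is a homogeneous polynomial $F=x_1g_1+\dots+x_sg_s+g\in\mathbb{K}[x_1,\dots,x_s,u_1,\dots,u_m]$ with $g_1,\dots,g_s,g\in\mathbb{K}[u_1,\dots,u_m]$ such that the forms $g_1,\dots,g_s$ are linearly independent and algebraically dependent over $\mathbb{K}$ ($g=0$ is allowed). For a pure simplicial complex $\Delta$ on $\{1,\dots,m\}$ (all facets of the same dimension) with facets $F_1,\dots,F_s$, put $F(\Delta)=\sum_{i=1}^s x_iu_{F_i}\in\mathbb{K}[x_1,\dots,x_s,u_1,\dots,u_m]$, where $u_{F_i}=\prod_{j\in F_i}u_j$. If $F(\Delta)$ is a Perazzo form it is called a simplicial Perazzo form. Macaulay duality: for a polynomial ring $R=\mathbb{K}[z_1,\dots,z_N]$ acting on $S=\mathbb{K}[Z_1,\dots,Z_N]$ by $z_i=\partial/\partial Z_i$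 and a homogeneous $F\in S$, put $A_F=R/\{g\in R: g\circ F=0\}$; it is a standard graded artinian Gorenstein algebra with socle degree $\deg F$ (the largest degree in which it is nonzero). A Perazzo algebra is $A_F$ for a Perazzo form $F$; a simplicial Perazzo algebra is $A_{F(\Delta)}$ for a simplicial Perazzo form $F(\Delta)$; it is called flag if $\Delta$ is a flag complex, i.e. the complex of independent sets of some graph (equivalently, every minimal nonface of $\Delta$ has size $2$). The Hilbert function is $h_i=\dim_{\mathbb{K}}A_i$, where $A_i$ is the degree $i$ component of the algebra $A$. The first half of the Hilbert function of an algebra of socle degree $d$ is the sequence $(h_1,\dots,h_{\lfloor d/2\rfloor})$.
   Formalization: The case d = 2 is excluded: a Perazzo form of degree 2 would need linearly independent linear forms that are algebraically dependent, which is impossible, so the collection is empty and not unconstrained; every other positive d is covered. *)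

theory Defs
  imports
    "HOL-Algebra.Algebra"
    "HOL-Library.Poly_Mapping"
    "HOL-Library.FuncSet"
    "HOL-Combinatorics.Permutations"
begin

section \<open>Polynomials in several variables\<close>

text \<open>A monomial is a finitely supported exponent function, a polynomial a finitely supported
  function from monomials to coefficients. The ring structure is that of the type
  \<^typ>\<open>('v \<Rightarrow>\<^sub>0 nat) \<Rightarrow>\<^sub>0 'k\<close>; polynomial rings in finitely many variables are carved
  out by \<open>polys_in\<close>.\<close>

type_synonym ('v, 'k) mpoly = "('v \<Rightarrow>\<^sub>0 nat) \<Rightarrow>\<^sub>0 'k"

definition Const :: "'k \<Rightarrow> ('v, 'k::zero) mpoly" where
  "Const c = Poly_Mapping.single 0 c"

definition Var :: "'v \<Rightarrow> ('v, 'k::zero_neq_one) mpoly" where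
  "Var v = Poly_Mapping.single (Poly_Mapping.single v 1) 1"

definition polys_in :: "'v set \<Rightarrow> ('v, 'k::zero) mpoly set" where
  "polys_in V = {p. \<forall>a\<in>Poly_Mapping.keys p. Poly_Mapping.keys a \<subseteq> V}"

definition mdegree :: "('v \<Rightarrow>\<^sub>0 nat) \<Rightarrow> nat" where
  "mdegree a = (\<Sum>v\<in>Poly_Mapping.keys a. Poly_Mapping.lookup a v)"

text \<open>The zero polynomial is homogeneous of every degree.\<close>

definition homogeneous :: "nat \<Rightarrow> ('v, 'k::zero) mpoly \<Rightarrow> bool" where
  "homogeneous n p \<longleftrightarrow> (\<forall>a\<in>Poly_Mapping.keys p. mdegree a = n)"

definition subst :: "('v \<Rightarrow> ('w, 'k::comm_ring_1) mpoly) \<Rightarrow> ('v, 'k) mpoly \<Rightarrow> ('w, 'k) mpoly" where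
  "subst g p = (\<Sum>a\<in>Poly_Mapping.keys p. Const (Poly_Mapping.lookup p a) *
     (\<Prod>v\<in>Poly_Mapping.keys a. g v ^ Poly_Mapping.lookup a v))"

definition lin_indep_family :: "'i set \<Rightarrow> ('i \<Rightarrow> ('v, 'k::comm_ring_1) mpoly) \<Rightarrow> bool" where
  "lin_indep_family I g \<longleftrightarrow>
     (\<forall>c :: 'i \<Rightarrow> 'k. (\<Sum>i\<in>I. Const (c i) * g i) = 0 \<longrightarrow> (\<forall>i\<in>I. c i = 0))"

definition alg_dep_family :: "'i set \<Rightarrow> ('i \<Rightarrow> ('v, 'k::comm_ring_1) mpoly) \<Rightarrow> bool" where
  "alg_dep_family I g \<longleftrightarrow> (\<exists>P :: ('i, 'k) mpoly. P \<in> polys_in I \<and> P \<noteq> 0 \<and> subst g P = 0)"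


section \<open>Macaulay duality\<close>

text \<open>In \<open>pdiff\<close> the truncated subtraction of exponents is harmless: if \<open>v\<close> does not occur in
  a monomial, then its contribution has coefficient \<open>0\<close>.\<close>

definition pdiff :: "'v \<Rightarrow> ('v, 'k::comm_ring_1) mpoly \<Rightarrow> ('v, 'k) mpoly" where
  "pdiff v p = (\<Sum>a\<in>Poly_Mapping.keys p.
     Poly_Mapping.single (a - Poly_Mapping.single v 1)
       (of_nat (Poly_Mapping.lookup a v) * Poly_Mapping.lookup p a))"

lemma lookup_pdiff:
  "Poly_Mapping.lookup (pdiff v p) c =
     of_nat (Suc (Poly_Mapping.lookup c v)) * Poly_Mapping.lookup p (c + Poly_Mapping.single v 1)"
proof -
  let ?e = "Poly_Mapping.single v (1::nat)"
  have eq: "Poly_Mapping.lookup (Poly_Mapping.single (a - ?e)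
        (of_nat (Poly_Mapping.lookup a v) * Poly_Mapping.lookup p a)) c =
      (if a = c + ?e
       then of_nat (Suc (Poly_Mapping.lookup c v)) * Poly_Mapping.lookup p (c + ?e) else 0)" for a
  proof (cases "a = c + ?e")
    case True
    then show ?thesis by (simp add: lookup_add)
  next
    case False
    have "Poly_Mapping.lookup a v = 0" if "a - ?e = c"
    proof (rule ccontr)
      assume "Poly_Mapping.lookup a v \<noteq> 0"
      then have "a = a - ?e + ?e"
        by (intro poly_mapping_eqI) (auto simp: lookup_add lookup_minus lookup_single when_def)
      with that False show False by simp
    qed
    with False show ?thesis by (auto simp: lookup_single when_def)
  qed
  show ?thesis
    unfolding pdiff_def lookup_sum eq by (auto simp: in_keys_iff)
qed

lemma pdiff_commute: "pdiff v (pdiff w p) = pdiff w (pdiff v p)"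
  by (rule poly_mapping_eqI)
     (cases "v = w"; simp add: lookup_pdiff lookup_add lookup_single when_def algebra_simps)

text \<open>The monomial \<open>a\<close> acts as the composition of the operators \<open>(\<partial>/\<partial>v)\<^bsup>a v\<^esup>\<close>. The fold is
  independent of the order of the variables because these operators commute.\<close>

definition mono_diff :: "('v \<Rightarrow>\<^sub>0 nat) \<Rightarrow> ('v, 'k::comm_ring_1) mpoly \<Rightarrow> ('v, 'k) mpoly" where
  "mono_diff a F = Finite_Set.fold (\<lambda>v. pdiff v ^^ Poly_Mapping.lookup a v) F (Poly_Mapping.keys a)"

lemma comp_fun_commute_pdiff: "comp_fun_commute pdiff"
  by standard (simp add: fun_eq_iff pdiff_commute)

lemma mono_diff_single: "mono_diff (Poly_Mapping.single v n) F = (pdiff v ^^ n) F"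
proof -
  interpret comp_fun_commute "\<lambda>w. pdiff w ^^ Poly_Mapping.lookup (Poly_Mapping.single v n) w"
    by (rule comp_fun_commute.comp_fun_commute_funpow[OF comp_fun_commute_pdiff])
  show ?thesis by (cases "n = 0") (simp_all add: mono_diff_def)
qed

text \<open>The dual rings \<open>R\<close> (operators) and \<open>S\<close> (forms) are the same polynomial ring.\<close>

definition diff_action :: "('v, 'k::comm_ring_1) mpoly \<Rightarrow> ('v, 'k) mpoly \<Rightarrow> ('v, 'k) mpoly" where
  "diff_action g F =
     (\<Sum>a\<in>Poly_Mapping.keys g. Const (Poly_Mapping.lookup g a) * mono_diff a F)"

lemma diff_action_Var: "diff_action (Var v) F = pdiff v F"
proof -
  have "Const 1 = (1 :: ('a, 'b) mpoly)" by (simp add: Const_def)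
  moreover have "mono_diff (Poly_Mapping.single v (Suc 0)) F = pdiff v F"
    using mono_diff_single[of v "Suc 0" F] by simp
  ultimately show ?thesis by (simp add: diff_action_def Var_def)
qed

definition mpoly_ring :: "'v set \<Rightarrow> ('v, 'k::comm_ring_1) mpoly ring" where
  "mpoly_ring V = \<lparr>carrier = polys_in V, monoid.mult = (*), one = 1, ring.zero = 0, add = (+)\<rparr>"

definition ann :: "'v set \<Rightarrow> ('v, 'k::comm_ring_1) mpoly \<Rightarrow> ('v, 'k) mpoly set" where
  "ann V F = {g \<in> polys_in V. diff_action g F = 0}"

definition macaulay_algebra ::
    "'v set \<Rightarrow> ('v, 'k::comm_ring_1) mpoly \<Rightarrow> ('v, 'k) mpoly set ring" where
  "macaulay_algebra V F = mpoly_ring V Quot ann V F"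

definition residue_class ::
    "'v set \<Rightarrow> ('v, 'k::comm_ring_1) mpoly \<Rightarrow> ('v, 'k) mpoly \<Rightarrow> ('v, 'k) mpoly set" where
  "residue_class V F g = ann V F +>\<^bsub>mpoly_ring V\<^esub> g"

definition scalars :: "'v set \<Rightarrow> ('v, 'k::comm_ring_1) mpoly \<Rightarrow> ('v, 'k) mpoly set set" where
  "scalars V F = residue_class V F ` Set.range Const"

definition graded_component ::
    "'v set \<Rightarrow> ('v, 'k::comm_ring_1) mpoly \<Rightarrow> nat \<Rightarrow> ('v, 'k) mpoly set set" where
  "graded_component V F i = residue_class V F ` {g \<in> polys_in V. homogeneous i g}"

text \<open>The ground field acts on \<open>A\<^sub>F\<close> through its image \<open>scalars V F\<close>, an isomorphic copy of it
  whenever \<open>A\<^sub>F \<noteq> 0\<close>, that is, whenever \<open>F \<noteq> 0\<close>.\<close>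

definition hilbert_function :: "'v set \<Rightarrow> ('v, 'k::field) mpoly \<Rightarrow> nat \<Rightarrow> nat" where
  "hilbert_function V F i =
     ring.dim (macaulay_algebra V F) (scalars V F) (graded_component V F i)"

definition socle_degree :: "'v set \<Rightarrow> ('v, 'k::field) mpoly \<Rightarrow> nat" where
  "socle_degree V F =
     (GREATEST i. graded_component V F i \<noteq> {\<zero>\<^bsub>macaulay_algebra V F\<^esub>})"


section \<open>Perazzo forms\<close>

datatype pvar = XVar nat | UVar nat

definition perazzo_vars :: "nat \<Rightarrow> nat \<Rightarrow> pvar set" where
  "perazzo_vars s m = XVar ` {1..s} \<union> UVar ` {1..m}"

definition perazzo_form :: "nat \<Rightarrow> nat \<Rightarrow> (pvar, 'k::field) mpoly \<Rightarrow> bool" where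
  "perazzo_form s m F \<longleftrightarrow>
     (\<exists>e. homogeneous e F) \<and>
     (\<exists>g g0. (\<forall>i\<in>{1..s}. g i \<in> polys_in (UVar ` {1..m})) \<and> g0 \<in> polys_in (UVar ` {1..m}) \<and>
        F = (\<Sum>i=1..s. Var (XVar i) * g i) + g0 \<and>
        lin_indep_family {1..s} g \<and> alg_dep_family {1..s} g)"


section \<open>Simplicial Perazzo forms\<close>

definition simplicial_complex_on :: "nat \<Rightarrow> nat set set \<Rightarrow> bool" where
  "simplicial_complex_on m \<Delta> \<longleftrightarrow>
     \<Delta> \<subseteq> Pow {1..m} \<and> {} \<in> \<Delta> \<and> (\<forall>i\<in>{1..m}. {i} \<in> \<Delta>) \<and>
     (\<forall>S\<in>\<Delta>. \<forall>T. T \<subseteq> S \<longrightarrow> T \<in> \<Delta>)"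

definition facets :: "nat set set \<Rightarrow> nat set set" where
  "facets \<Delta> = {S \<in> \<Delta>. \<forall>T\<in>\<Delta>. S \<subseteq> T \<longrightarrow> S = T}"

definition pure_complex :: "nat set set \<Rightarrow> bool" where
  "pure_complex \<Delta> \<longleftrightarrow> (\<forall>S\<in>facets \<Delta>. \<forall>T\<in>facets \<Delta>. card S = card T)"

definition independence_complex :: "nat \<Rightarrow> nat set set \<Rightarrow> nat set set" where
  "independence_complex m E = {S. S \<subseteq> {1..m} \<and> (\<forall>e\<in>E. \<not> e \<subseteq> S)}"

definition flag_complex_on :: "nat \<Rightarrow> nat set set \<Rightarrow> bool" where
  "flag_complex_on m \<Delta> \<longleftrightarrow>
     (\<exists>E. E \<subseteq> {e. e \<subseteq> {1..m} \<and> card e = 2} \<and> \<Delta> = independence_complex m E)"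

text \<open>The facets are listed as \<open>Fc 1, \<dots>, Fc s\<close>; the choice of the enumeration only permutes
  the variables \<open>XVar i\<close>.\<close>

definition simplicial_form :: "nat \<Rightarrow> (nat \<Rightarrow> nat set) \<Rightarrow> (pvar, 'k::field) mpoly" where
  "simplicial_form s Fc = (\<Sum>i=1..s. Var (XVar i) * (\<Prod>j\<in>Fc i. Var (UVar j)))"

definition form_of_complex ::
    "nat \<Rightarrow> nat \<Rightarrow> nat set set \<Rightarrow> (pvar, 'k::field) mpoly \<Rightarrow> bool" where
  "form_of_complex s m \<Delta> F \<longleftrightarrow>
     simplicial_complex_on m \<Delta> \<and> pure_complex \<Delta> \<and>
     (\<exists>Fc. bij_betw Fc {1..s} (facets \<Delta>) \<and> F = simplicial_form s Fc)"

definition simplicial_perazzo_form :: "nat \<Rightarrow> nat \<Rightarrow> (pvar, 'k::field) mpoly \<Rightarrow> bool" where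
  "simplicial_perazzo_form s m F \<longleftrightarrow>
     (\<exists>\<Delta>. form_of_complex s m \<Delta> F) \<and> perazzo_form s m F"

definition flag_simplicial_perazzo_form :: "nat \<Rightarrow> nat \<Rightarrow> (pvar, 'k::field) mpoly \<Rightarrow> bool" where
  "flag_simplicial_perazzo_form s m F \<longleftrightarrow>
     (\<exists>\<Delta>. form_of_complex s m \<Delta> F \<and> flag_complex_on m \<Delta>) \<and> perazzo_form s m F"


section \<open>Unconstrained collections\<close>

text \<open>A sequence of length \<open>q\<close> is a function on \<open>{1..q}\<close>, extended by \<^term>\<open>undefined\<close>.\<close>

definition unconstrained :: "nat \<Rightarrow> (nat \<Rightarrow> nat) set \<Rightarrow> bool" where
  "unconstrained q H \<longleftrightarrow>
     (\<forall>\<pi>. \<pi> permutes {1..q} \<longrightarrow> (\<exists>a\<in>H. strict_mono_on {1..q} (\<lambda>i. a (\<pi> i))))"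

text \<open>\<open>first_halves P d\<close> collects the first halves of the Hilbert functions of the algebras
  \<open>A\<^sub>F\<close> of socle degree \<open>d\<close>, for the forms \<open>F\<close> in \<open>\<K>[x\<^sub>1,\<dots>,x\<^sub>s,u\<^sub>1,\<dots>,u\<^sub>m]\<close> of the kind
  \<open>P\<close>. For \<open>d = 2\<close> the collection is empty in the case of Perazzo forms, since linearly
  independent linear forms are algebraically independent. Hence it is not unconstrained:
  already for \<open>q = 1\<close> that property requires a nonempty collection.\<close>

definition first_halves ::
    "(nat \<Rightarrow> nat \<Rightarrow> (pvar, 'k::field) mpoly \<Rightarrow> bool) \<Rightarrow> nat \<Rightarrow> (nat \<Rightarrow> nat) set" where
  "first_halves P d =
     {restrict (hilbert_function (perazzo_vars s m) F) {1..d div 2} | s m F.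
        P s m F \<and> socle_degree (perazzo_vars s m) F = d}"

end

theory Submission
  imports Defs
begin

text \<open>If the facets of \<open>\<Delta>\<close> have \<open>n = d - 1\<close> vertices and \<open>N\<^sub>k\<close> is the number of faces with \<open>k\<close>
  vertices, then \<open>h\<^sub>i = N\<^sub>i + N\<^bsub>d - i\<^esub>\<close>: the form is squarefree, so operators act by shifting
  exponents, and the derivatives \<open>u\<^sub>S \<circ> F\<close> have disjoint supports, while the operators involving
  an \<open>x\<^sub>i\<close> produce exactly the monomials \<open>u\<^sub>T\<close> of faces \<open>T\<close>. Disjoint unions of flag complexes are
  flag and add the numbers \<open>N\<^sub>k\<close>. Take \<open>c\<^sub>r t\<^bsup>n - r\<^esup>\<close> copies of the join of \<open>n\<close> discrete sets,
  \<open>r\<close> of them with \<open>t\<close> points and the others with one point, for \<open>r = 1, \<dots>, n\<close>. As \<open>t\<close> grows, \<open>h\<^sub>i\<close>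
  is asymptotic to \<open>t\<^bsup>n\<^esup>\<close> times a linear function of the weights \<open>c\<close>, which takes the same value for
  all \<open>i\<close> at \<open>c\<^sub>r = 2\<^bsup>r - 1\<^esup>\<close>. Since the linear functions are independent, perturbing these weights
  gives every order. Algebraic dependence comes from a relation \<open>u\<^bsub>A\<^esub> u\<^bsub>B\<^esub> = u\<^bsub>C\<^esub> u\<^bsub>D\<^esub>\<close> among four
  facets.\<close>

section \<open>Differentiation of squarefree forms\<close>

text \<open>Exponents at most one turn every factor produced by differentiation into 1, so operators
  act by shifting exponents.\<close>

definition squarefree_form :: "('v, 'k::zero) mpoly \<Rightarrow> bool" where
  "squarefree_form F \<longleftrightarrow> (\<forall>e. Poly_Mapping.lookup F e \<noteq> 0 \<longrightarrow> (\<forall>v. Poly_Mapping.lookup e v \<le> 1))"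

lemma lookup_pdiff_squarefree:
  assumes "squarefree_form F"
  shows "Poly_Mapping.lookup (pdiff v F) c = Poly_Mapping.lookup F (c + Poly_Mapping.single v 1)"
proof (cases "Poly_Mapping.lookup F (c + Poly_Mapping.single v 1) = 0")
  case False
  then have "Poly_Mapping.lookup (c + Poly_Mapping.single v 1) v \<le> 1"
    using assms unfolding squarefree_form_def by blast
  then have "Poly_Mapping.lookup c v = 0" by (simp add: lookup_add)
  then show ?thesis by (simp add: lookup_pdiff)
qed (simp add: lookup_pdiff)

lemma squarefree_form_pdiff:
  assumes "squarefree_form F"
  shows "squarefree_form (pdiff v F)"
  unfolding squarefree_form_def
proof (intro allI impI)
  fix e w
  assume "Poly_Mapping.lookup (pdiff v F) e \<noteq> 0"
  then have "Poly_Mapping.lookup (e + Poly_Mapping.single v 1) w \<le> 1"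
    using assms unfolding lookup_pdiff_squarefree[OF assms] squarefree_form_def by blast
  then show "Poly_Mapping.lookup e w \<le> 1" by (simp add: lookup_add)
qed

text \<open>Both claims need one induction, because the shift formula for the next derivative uses
  squarefreeness of the current one. For \<open>n \<ge> 2\<close> both coefficients vanish.\<close>

lemma pdiff_funpow_squarefree:
  assumes "squarefree_form F"
  shows "squarefree_form ((pdiff v ^^ n) F) \<and>
    (\<forall>c. Poly_Mapping.lookup ((pdiff v ^^ n) F) c = Poly_Mapping.lookup F (c + Poly_Mapping.single v n))"
proof (induction n)
  case 0
  then show ?case using assms by simp
next
  case (Suc n)
  then show ?case
    by (simp add: squarefree_form_pdiff lookup_pdiff_squarefree add.assoc flip: single_add)
qed

lemma poly_mapping_sum_single:
  "(\<Sum>v\<in>Poly_Mapping.keys a. Poly_Mapping.single v (Poly_Mapping.lookup a v)) = a"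
  by (rule poly_mapping_eqI)
     (auto simp: lookup_sum lookup_single when_def in_keys_iff)

lemma lookup_mono_diff:
  assumes "squarefree_form F"
  shows "Poly_Mapping.lookup (mono_diff a F) c = Poly_Mapping.lookup F (c + a)"
proof -
  interpret comp_fun_commute "\<lambda>w. pdiff w ^^ Poly_Mapping.lookup a w"
    by (rule comp_fun_commute.comp_fun_commute_funpow[OF comp_fun_commute_pdiff])
  let ?D = "\<lambda>A. Finite_Set.fold (\<lambda>w. pdiff w ^^ Poly_Mapping.lookup a w) F A"
  \<comment> \<open>Keeping squarefreeness along partial folds lets the shift formula apply to each
    further variable; the shifts made so far add up to \<open>a\<close> restricted to
    \<open>A\<close>.\<close>
  have "squarefree_form (?D A) \<and> (\<forall>c. Poly_Mapping.lookup (?D A) c =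
      Poly_Mapping.lookup F (c + (\<Sum>v\<in>A. Poly_Mapping.single v (Poly_Mapping.lookup a v))))"
    if "finite A" for A
    using that
  proof (induction A)
    case empty
    then show ?case using assms by simp
  next
    case (insert x A)
    then show ?case
      using pdiff_funpow_squarefree[of "?D A" "Poly_Mapping.lookup a x" x]
      by (simp add: add.assoc)
  qed
  from this[OF finite_keys, of a] show ?thesis
    by (simp add: mono_diff_def poly_mapping_sum_single)
qed

lemma lookup_Const_mult:
  "Poly_Mapping.lookup (Const x * p) c = x * Poly_Mapping.lookup p (c :: 'v \<Rightarrow>\<^sub>0 nat)"
  unfolding Const_def mult_map_scale_conv_mult[symmetric]
  by (simp add: Poly_Mapping.map.rep_eq when_def)

text \<open>This is the action by contraction; for squarefree \<open>F\<close> it gives the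
  coefficients of the derivative and reduces questions about operators to finite sums.\<close>

definition contract ::
    "('v, 'k::comm_ring_1) mpoly \<Rightarrow> ('v, 'k) mpoly \<Rightarrow> ('v \<Rightarrow>\<^sub>0 nat) \<Rightarrow> 'k" where
  "contract F g c =
     (\<Sum>a\<in>Poly_Mapping.keys g. Poly_Mapping.lookup g a * Poly_Mapping.lookup F (c + a))"

lemma lookup_diff_action:
  assumes "squarefree_form F"
  shows "Poly_Mapping.lookup (diff_action g F) c = contract F g c"
  by (simp add: diff_action_def contract_def lookup_sum lookup_Const_mult lookup_mono_diff[OF assms])

lemma contract_superset:
  assumes "finite A" "Poly_Mapping.keys g \<subseteq> A"
  shows "contract F g c = (\<Sum>a\<in>A. Poly_Mapping.lookup g a * Poly_Mapping.lookup F (c + a))"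
  unfolding contract_def using assms
  by (intro sum.mono_neutral_left) (auto simp: in_keys_iff)

lemma contract_add: "contract F (g + h) c = contract F g c + contract F h c"
proof -
  let ?A = "Poly_Mapping.keys g \<union> Poly_Mapping.keys h"
  have "Poly_Mapping.keys (g + h) \<subseteq> ?A" by (rule keys_add)
  then show ?thesis
    by (simp add: contract_superset[of ?A] lookup_add distrib_right sum.distrib)
qed

lemma contract_zero [simp]: "contract F 0 c = 0"
  by (simp add: contract_def)

lemma contract_uminus: "contract F (- g) c = - contract F g c"
  using contract_add[of F g "- g" c] by (simp add: eq_neg_iff_add_eq_0 add.commute)

lemma contract_diff: "contract F (g - h) c = contract F g c - contract F h c"
  using contract_add[of F g "- h" c] by (simp add: contract_uminus)

lemma contract_sum: "contract F (\<Sum>i\<in>I. g i) c = (\<Sum>i\<in>I. contract F (g i) c)"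
  by (induction I rule: infinite_finite_induct) (simp_all add: contract_add)

lemma contract_single: "contract F (Poly_Mapping.single a x) c = x * Poly_Mapping.lookup F (c + a)"
  by (cases "x = 0") (simp_all add: contract_def)

text \<open>The right side vanishes along with all contractions by \<open>g\<close>, which makes the
  annihilator closed under multiplication.\<close>

lemma contract_mult:
  "contract F (h * g) c = (\<Sum>a\<in>Poly_Mapping.keys h. Poly_Mapping.lookup h a * contract F g (c + a))"
proof -
  have "h * g = (\<Sum>a\<in>Poly_Mapping.keys h. Poly_Mapping.single a (Poly_Mapping.lookup h a)) *
      (\<Sum>b\<in>Poly_Mapping.keys g. Poly_Mapping.single b (Poly_Mapping.lookup g b))"
    by (simp add: poly_mapping_sum_single)
  also have "\<dots> = (\<Sum>a\<in>Poly_Mapping.keys h. \<Sum>b\<in>Poly_Mapping.keys g.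
      Poly_Mapping.single (a + b) (Poly_Mapping.lookup h a * Poly_Mapping.lookup g b))"
    by (simp add: sum_product mult_single)
  finally show ?thesis
    by (simp add: contract_sum contract_single contract_def[of F g] sum_distrib_left mult.assoc add.assoc)
qed

section \<open>The Macaulay algebra of a squarefree form\<close>

lemma polys_in_add: "p \<in> polys_in V \<Longrightarrow> q \<in> polys_in V \<Longrightarrow> p + q \<in> polys_in V"
  unfolding polys_in_def using keys_add[of p q] by blast

lemma polys_in_uminus: "p \<in> polys_in V \<Longrightarrow> - p \<in> polys_in (V :: 'v set)"
  for p :: "('v, 'k::comm_ring_1) mpoly"
  unfolding polys_in_def by (auto simp: in_keys_iff)

lemma polys_in_mult: "p \<in> polys_in V \<Longrightarrow> q \<in> polys_in V \<Longrightarrow> p * q \<in> polys_in V"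
proof -
  assume *: "p \<in> polys_in V" "q \<in> polys_in V"
  show ?thesis
    unfolding polys_in_def
  proof safe
    fix a v assume a: "a \<in> Poly_Mapping.keys (p * q)" "v \<in> Poly_Mapping.keys a"
    then obtain b c where "b \<in> Poly_Mapping.keys p" "c \<in> Poly_Mapping.keys q" "a = b + c"
      using keys_mult[of p q] by blast
    with a * show "v \<in> V" using keys_add[of b c] unfolding polys_in_def by blast
  qed
qed

lemma polys_in_single: "Poly_Mapping.keys a \<subseteq> V \<Longrightarrow> Poly_Mapping.single a x \<in> polys_in V"
  unfolding polys_in_def by auto

lemma polys_in_zero: "0 \<in> polys_in V"
  unfolding polys_in_def by simp

lemma polys_in_one: "1 \<in> polys_in V"
  unfolding polys_in_def by simp

lemma polys_in_Const: "Const x \<in> polys_in V"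
  unfolding Const_def by (rule polys_in_single) simp

lemma polys_in_Var: "v \<in> V \<Longrightarrow> Var v \<in> polys_in V"
  unfolding Var_def by (rule polys_in_single) simp

lemma polys_in_sum: "(\<And>i. i \<in> I \<Longrightarrow> p i \<in> polys_in V) \<Longrightarrow> (\<Sum>i\<in>I. p i) \<in> polys_in V"
  by (induction I rule: infinite_finite_induct) (auto simp: polys_in_zero polys_in_add)

lemma polys_in_prod: "(\<And>i. i \<in> I \<Longrightarrow> p i \<in> polys_in V) \<Longrightarrow> (\<Prod>i\<in>I. p i) \<in> polys_in V"
  by (induction I rule: infinite_finite_induct) (auto simp: polys_in_one polys_in_mult)

lemma mpoly_ring_simps [simp]:
  "carrier (mpoly_ring V) = polys_in V"
  "x \<otimes>\<^bsub>mpoly_ring V\<^esub> y = x * y"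
  "\<one>\<^bsub>mpoly_ring V\<^esub> = 1"
  "\<zero>\<^bsub>mpoly_ring V\<^esub> = 0"
  "x \<oplus>\<^bsub>mpoly_ring V\<^esub> y = x + y"
  by (simp_all add: mpoly_ring_def)

lemma cring_mpoly_ring: "cring (mpoly_ring V)"
proof (rule cringI)
  show "abelian_group (mpoly_ring V)"
  proof (rule abelian_groupI)
    fix x assume "x \<in> carrier (mpoly_ring V)"
    then show "\<exists>y\<in>carrier (mpoly_ring V). y \<oplus>\<^bsub>mpoly_ring V\<^esub> x = \<zero>\<^bsub>mpoly_ring V\<^esub>"
      by (intro bexI[of _ "- x"]) (simp_all add: polys_in_uminus)
  qed (simp_all add: polys_in_add polys_in_zero add.assoc add.commute)
  show "Group.comm_monoid (mpoly_ring V)"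
    by (rule comm_monoidI) (simp_all add: polys_in_mult polys_in_one mult.assoc mult.commute)
qed (simp add: distrib_right)

lemma a_inv_mpoly_ring: "p \<in> polys_in V \<Longrightarrow> \<ominus>\<^bsub>mpoly_ring V\<^esub> p = - p"
proof -
  assume p: "p \<in> polys_in V"
  interpret cring "mpoly_ring V" by (rule cring_mpoly_ring)
  show ?thesis
    using minus_equality[of "- p" p] p polys_in_uminus[OF p] by simp
qed

lemma mem_ann_iff:
  assumes "squarefree_form F"
  shows "g \<in> ann V F \<longleftrightarrow> g \<in> polys_in V \<and> (\<forall>c. contract F g c = 0)"
  by (simp add: ann_def poly_mapping_eq_iff fun_eq_iff lookup_diff_action[OF assms])

lemma ideal_ann:
  fixes F :: "('v, 'k::comm_ring_1) mpoly"
  assumes "squarefree_form F"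
  shows "ideal (ann V F) (mpoly_ring V)"
proof -
  interpret cring "mpoly_ring V :: ('v, 'k) mpoly ring" by (rule cring_mpoly_ring)
  note mem = mem_ann_iff[OF assms]
  show ?thesis
  proof (rule idealI)
    show "subgroup (ann V F) (add_monoid (mpoly_ring V))"
    proof (rule add.subgroupI)
      fix a assume "a \<in> ann V F"
      then show "\<ominus>\<^bsub>mpoly_ring V\<^esub> a \<in> ann V F"
        by (simp add: mem a_inv_mpoly_ring contract_uminus polys_in_uminus)
    next
      have "0 \<in> ann V F" by (simp add: mem polys_in_zero)
      then show "ann V F \<noteq> {}" by blast
    qed (auto simp: mem contract_add polys_in_add)
    fix a x :: "('v, 'k) mpoly" assume *: "a \<in> ann V F" "x \<in> carrier (mpoly_ring V)"
    then show "x \<otimes>\<^bsub>mpoly_ring V\<^esub> a \<in> ann V F"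
      by (simp add: mem polys_in_mult contract_mult)
    then show "a \<otimes>\<^bsub>mpoly_ring V\<^esub> x \<in> ann V F"
      by (simp add: mult.commute)
  qed (rule ring_axioms)
qed

lemma residue_class_eq_zero_iff:
  assumes "squarefree_form F" "g \<in> polys_in V"
  shows "residue_class V F g = \<zero>\<^bsub>macaulay_algebra V F\<^esub> \<longleftrightarrow> g \<in> ann V F"
proof -
  interpret I: ideal "ann V F" "mpoly_ring V" by (rule ideal_ann[OF assms(1)])
  have "ann V F +>\<^bsub>mpoly_ring V\<^esub> g = ann V F \<longleftrightarrow> g \<in> ann V F"
    using I.a_rcos_self[of g] I.a_rcos_const[of g] assms(2) by auto
  then show ?thesis
    by (simp add: residue_class_def macaulay_algebra_def FactRing_def)
qed

lemma residue_class_eq_iff: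
  assumes "squarefree_form F" "g \<in> polys_in V" "h \<in> polys_in V"
  shows "residue_class V F g = residue_class V F h \<longleftrightarrow> (\<forall>c. contract F g c = contract F h c)"
proof -
  interpret I: ideal "ann V F" "mpoly_ring V" by (rule ideal_ann[OF assms(1)])
  have "residue_class V F g = residue_class V F h \<longleftrightarrow> g - h \<in> ann V F"
    unfolding residue_class_def using I.quotient_eq_iff_same_a_r_cos[OF I.ideal_axioms, of g h] assms(2,3)
    by (simp add: a_minus_def a_inv_mpoly_ring)
  then show ?thesis
    using polys_in_add[OF assms(2) polys_in_uminus[OF assms(3)]]
    by (simp add: mem_ann_iff[OF assms(1)] contract_diff)
qed

lemma residue_class_hom:
  assumes "squarefree_form F"
  shows "ring_hom_ring (mpoly_ring V) (macaulay_algebra V F) (residue_class V F)"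
  using ideal.rcos_ring_hom_ring[OF ideal_ann[OF assms, of V]]
  by (simp add: macaulay_algebra_def residue_class_def[abs_def])

lemma subfield_Const: "subfield (Const ` (UNIV :: 'k::field set)) (mpoly_ring (V :: 'v set))"
proof -
  interpret cring "mpoly_ring V :: ('v, 'k) mpoly ring" by (rule cring_mpoly_ring)
  have add: "Const x + Const y = (Const (x + y) :: ('v, 'k) mpoly)" for x y
    by (simp add: Const_def single_add)
  have mult: "Const x * Const y = (Const (x * y) :: ('v, 'k) mpoly)" for x y
    by (simp add: Const_def mult_single)
  have neg: "- Const x = (Const (- x) :: ('v, 'k) mpoly)" for x
    by (simp add: Const_def single_uminus)
  have one: "Const 1 = (1 :: ('v, 'k) mpoly)" and zero: "Const 0 = (0 :: ('v, 'k) mpoly)"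
    by (simp_all add: Const_def)
  have nz: "Const x = (0 :: ('v, 'k) mpoly) \<longleftrightarrow> x = 0" for x
    by (metis Const_def lookup_single_eq lookup_zero zero)
  show ?thesis
  proof (rule subfieldI)
    have "subring (Const ` UNIV) (mpoly_ring V :: ('v, 'k) mpoly ring)"
      by (rule subringI)
        (auto simp: add mult polys_in_Const a_inv_mpoly_ring neg one[symmetric])
    then show "subcring (Const ` UNIV) (mpoly_ring V :: ('v, 'k) mpoly ring)"
      by (rule subcringI')
    show "Units ((mpoly_ring V :: ('v, 'k) mpoly ring) \<lparr>carrier := Const ` UNIV\<rparr>) = Const ` UNIV - {\<zero>\<^bsub>mpoly_ring V\<^esub>}"
    proof -
      have "\<exists>y. y * x = 1" if "x \<noteq> 0" for x :: 'k
        using that by (intro exI[of _ "inverse x"]) simp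
      moreover have "Const x = (1 :: ('v, 'k) mpoly) \<longleftrightarrow> x = 1" for x
        using one by (metis Const_def lookup_single_eq)
      ultimately show ?thesis
        by (auto simp: Units_def mult nz mult.commute)
    qed
  qed
qed

text \<open>\<open>B\<close> represents the distinct nonzero derivatives of \<open>F\<close> in degree \<open>i\<close>; the separating
  coefficients in the last assumption make them linearly independent.\<close>

lemma hilbert_function_eq_card:
  fixes F :: "('v, 'k::field) mpoly"
  assumes sf: "squarefree_form F" and nz: "F \<noteq> 0"
    and fin: "finite B"
    and B: "\<And>b. b \<in> B \<Longrightarrow> Poly_Mapping.keys b \<subseteq> V \<and> mdegree b = i"
    and span: "\<And>a. Poly_Mapping.keys a \<subseteq> V \<Longrightarrow> mdegree a = i \<Longrightarrow>
      (\<forall>c. Poly_Mapping.lookup F (c + a) = 0) \<or>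
      (\<exists>b\<in>B. \<forall>c. Poly_Mapping.lookup F (c + a) = Poly_Mapping.lookup F (c + b))"
    and sep: "\<And>b. b \<in> B \<Longrightarrow> \<exists>c. Poly_Mapping.lookup F (c + b) \<noteq> 0 \<and>
      (\<forall>b'\<in>B - {b}. Poly_Mapping.lookup F (c + b') = 0)"
  shows "hilbert_function V F i = card B"
proof -
  let ?R = "mpoly_ring V :: ('v, 'k) mpoly ring" and ?Q = "macaulay_algebra V F"
  let ?h = "residue_class V F" and ?K = "Const ` (UNIV :: 'k set) :: ('v, 'k) mpoly set"
  interpret ring_hom_ring ?R ?Q ?h by (rule residue_class_hom[OF sf])
  obtain bs where bs: "set bs = B" "distinct bs"
    using finite_distinct_list[OF fin] by blast
  let ?us = "map (\<lambda>b. Poly_Mapping.single b 1) bs :: ('v, 'k) mpoly list"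
  have us: "set ?us \<subseteq> carrier ?R"
    using B bs by (auto intro!: polys_in_single)
  have K: "subfield ?K ?R" by (rule subfield_Const)
  have KR: "?K \<subseteq> carrier ?R" by (auto simp: polys_in_Const)
  \<comment> \<open>A nonzero \<open>F\<close> keeps 1 out of the annihilator, so the quotient is
    nontrivial and the constants embed as a field.\<close>
  obtain c0 where "Poly_Mapping.lookup F c0 \<noteq> 0"
    using nz by (metis poly_mapping_eqI lookup_zero)
  then have "contract F 1 c0 \<noteq> 0"
    unfolding contract_def by simp
  then have "1 \<notin> ann V F"
    unfolding mem_ann_iff[OF sf] by blast
  then have one: "\<one>\<^bsub>?Q\<^esub> \<noteq> \<zero>\<^bsub>?Q\<^esub>"
    using residue_class_eq_zero_iff[OF sf polys_in_one, of V] hom_one by simp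
  have subf: "subfield (?h ` ?K) ?Q" and inj: "inj_on ?h ?K"
    using img_is_subfield[OF K one] by auto
  have comb: "R.combine (map (\<lambda>b. Const (x b)) l) (map (\<lambda>b. Poly_Mapping.single b 1) l) =
      (\<Sum>b\<leftarrow>l. Poly_Mapping.single b (x b))" for x :: "('v \<Rightarrow>\<^sub>0 nat) \<Rightarrow> 'k" and l
    by (induction l) (simp_all add: Const_def mult_single)
  \<comment> \<open>As \<open>bs\<close> is distinct, a list of coefficients is a function on the
    basis monomials, and combinations become sums over \<open>B\<close>.\<close>
  have Ks_ex: "\<exists>x. Ks = map (\<lambda>b. Const (x b)) bs"
    if "set Ks \<subseteq> ?K" "length Ks = length bs" for Ks
  proof -
    from that(1) obtain xs where xs: "Ks = map Const xs"
      using ex_map_conv[of Ks Const] by blast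
    show ?thesis
    proof (rule exI)
      show "Ks = map (\<lambda>b. Const ((the \<circ> map_of (zip bs xs)) b)) bs"
        using that(2) bs(2) unfolding xs by (intro nth_equalityI) (auto simp: map_of_zip_nth)
    qed
  qed
  have indep: "S.independent (?h ` ?K) (map ?h ?us)"
  proof (rule ccontr)
    assume dep: "S.dependent (?h ` ?K) (map ?h ?us)"
    have "set (map ?h ?us) \<subseteq> carrier ?Q" using us by auto
    from S.dependent_imp_non_trivial_combine[OF subf this dep] obtain Ls where
      Ls: "length Ls = length bs" "S.combine Ls (map ?h ?us) = \<zero>\<^bsub>?Q\<^esub>" "set Ls \<subseteq> ?h ` ?K"
        "set Ls \<noteq> {\<zero>\<^bsub>?Q\<^esub>}"
      by auto
    have "Ls \<in> lists (?h ` ?K)" using Ls(3) by blast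
    then obtain Ks where "Ks \<in> lists ?K" "Ls = map ?h Ks"
      unfolding lists_image by blast
    then have Ks: "Ls = map ?h Ks" "set Ks \<subseteq> ?K"
      by auto
    then obtain x where x: "Ks = map (\<lambda>b. Const (x b)) bs"
      using Ks_ex Ls(1) by auto
    let ?g = "\<Sum>b\<in>B. Poly_Mapping.single b (x b)"
    have "R.combine Ks ?us = ?g"
      using comb[of x bs] bs by (simp add: x sum_list_distinct_conv_sum_set)
    moreover have "S.combine Ls (map ?h ?us) = ?h (R.combine Ks ?us)"
      using combine_hom[of Ks ?us] Ks us KR by auto
    moreover have "?g \<in> polys_in V"
      using B by (intro polys_in_sum polys_in_single) auto
    ultimately have "contract F ?g c = 0" for c
      using Ls(2) residue_class_eq_zero_iff[OF sf, of ?g V] mem_ann_iff[OF sf, of ?g V] by simp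
    then have sum0: "(\<Sum>b\<in>B. x b * Poly_Mapping.lookup F (c + b)) = 0" for c
      by (simp add: contract_sum contract_single)
    \<comment> \<open>The separating coefficient for \<open>b\<close> leaves a single summand of the
      relation.\<close>
    have "x b = 0" if b: "b \<in> B" for b
    proof -
      obtain c where c: "Poly_Mapping.lookup F (c + b) \<noteq> 0"
          "\<forall>b'\<in>B - {b}. Poly_Mapping.lookup F (c + b') = 0"
        using sep[OF b] by blast
      have "(\<Sum>b'\<in>B. x b' * Poly_Mapping.lookup F (c + b')) = x b * Poly_Mapping.lookup F (c + b)"
        using c(2) by (subst sum.remove[OF fin b]) simp
      with sum0 c(1) show ?thesis by simp
    qed
    then have "Ls = map (\<lambda>_. \<zero>\<^bsub>?Q\<^esub>) bs"
      using bs hom_zero by (auto simp: Ks(1) x Const_def)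
    \<comment> \<open>An empty \<open>Ls\<close> would also satisfy the nontriviality condition,
      since its set is not the zero singleton; but the empty list is independent.\<close>
    moreover have "bs \<noteq> []"
      using dep by auto
    ultimately show False using Ls(4) by (cases bs) auto
  qed
  have sp: "S.Span (?h ` ?K) (map ?h ?us) = graded_component V F i"
  proof -
    have Span_eq: "R.Span ?K ?us = (\<lambda>x. \<Sum>b\<in>B. Poly_Mapping.single b (x b)) ` UNIV"
    proof -
      have "R.Span ?K ?us = range (\<lambda>x. R.combine (map (\<lambda>b. Const (x b)) bs) ?us)"
        unfolding R.Span_eq_combine_set_length_version[OF K us]
      proof safe
        fix Ks assume "length Ks = length ?us" "set Ks \<subseteq> ?K"
        then show "R.combine Ks ?us \<in> range (\<lambda>x. R.combine (map (\<lambda>b. Const (x b)) bs) ?us)"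
          using Ks_ex[of Ks] by auto
      next
        fix x :: "('v \<Rightarrow>\<^sub>0 nat) \<Rightarrow> 'k"
        show "\<exists>Ks. R.combine (map (\<lambda>b. Const (x b)) bs) ?us = R.combine Ks ?us \<and>
            length Ks = length ?us \<and> set Ks \<subseteq> ?K"
          by (intro exI[of _ "map (\<lambda>b. Const (x b)) bs"]) auto
      qed
      then show ?thesis
        using comb[of _ bs] bs by (simp add: sum_list_distinct_conv_sum_set)
    qed
    have "?h ` R.Span ?K ?us = graded_component V F i"
    proof safe
      fix p assume "p \<in> R.Span ?K ?us"
      then obtain x where p: "p = (\<Sum>b\<in>B. Poly_Mapping.single b (x b))"
        unfolding Span_eq by blast
      have "p \<in> polys_in V"
        unfolding p using B by (intro polys_in_sum polys_in_single) auto
      moreover have "homogeneous i p"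
        unfolding homogeneous_def p
        using B keys_sum[of "\<lambda>b. Poly_Mapping.single b (x b)" B] by (fastforce split: if_splits)
      ultimately show "?h p \<in> graded_component V F i"
        unfolding graded_component_def by blast
    next
      fix G assume "G \<in> graded_component V F i"
      then obtain g where g: "g \<in> polys_in V" "homogeneous i g" "G = ?h g"
        unfolding graded_component_def by blast
      \<comment> \<open>Monomials that annihilate \<open>F\<close> are dropped. Each remaining one
        is replaced by a basis monomial with the same action, and coefficients with equal
        replacement are added up.\<close>
      let ?A = "{a \<in> Poly_Mapping.keys g. \<exists>c. Poly_Mapping.lookup F (c + a) \<noteq> 0}"
      have "\<forall>a\<in>?A. \<exists>b. b \<in> B \<and> (\<forall>c. Poly_Mapping.lookup F (c + a) = Poly_Mapping.lookup F (c + b))"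
      proof
        fix a assume "a \<in> ?A"
        then have "Poly_Mapping.keys a \<subseteq> V" "mdegree a = i" "\<not> (\<forall>c. Poly_Mapping.lookup F (c + a) = 0)"
          using g(1,2) unfolding polys_in_def homogeneous_def by auto
        then show "\<exists>b. b \<in> B \<and> (\<forall>c. Poly_Mapping.lookup F (c + a) = Poly_Mapping.lookup F (c + b))"
          using span[of a] by blast
      qed
      from bchoice[OF this] obtain \<beta> where \<beta>: "\<And>a. a \<in> ?A \<Longrightarrow> \<beta> a \<in> B"
          "\<And>a c. a \<in> ?A \<Longrightarrow> Poly_Mapping.lookup F (c + a) = Poly_Mapping.lookup F (c + \<beta> a)"
        by blast
      define x where "x b = (\<Sum>a\<in>{a \<in> ?A. \<beta> a = b}. Poly_Mapping.lookup g a)" for b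
      let ?p = "\<Sum>b\<in>B. Poly_Mapping.single b (x b)"
      have "contract F g c = contract F ?p c" for c
      proof -
        have "contract F g c = (\<Sum>a\<in>?A. Poly_Mapping.lookup g a * Poly_Mapping.lookup F (c + a))"
          unfolding contract_def by (rule sum.mono_neutral_right) auto
        also have "\<dots> = (\<Sum>a\<in>?A. Poly_Mapping.lookup g a * Poly_Mapping.lookup F (c + \<beta> a))"
          using \<beta>(2) by (intro sum.cong) auto
        also have "\<dots> = (\<Sum>b\<in>B. \<Sum>a\<in>{a \<in> ?A. \<beta> a = b}.
            Poly_Mapping.lookup g a * Poly_Mapping.lookup F (c + \<beta> a))"
          using \<beta>(1) fin by (intro sum.group[symmetric]) auto
        also have "\<dots> = contract F ?p c"
          by (simp add: contract_sum contract_single x_def sum_distrib_right)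
        finally show ?thesis .
      qed
      moreover have "?p \<in> polys_in V"
        using B by (intro polys_in_sum polys_in_single) auto
      ultimately have "G = ?h ?p"
        using g(1,3) residue_class_eq_iff[OF sf] by blast
      then show "G \<in> ?h ` R.Span ?K ?us"
        unfolding Span_eq by blast
    qed
    then show ?thesis using Span_hom[OF KR us] by simp
  qed
  have "S.dimension (length bs) (?h ` ?K) (graded_component V F i)"
    using S.dimension_independent[OF indep] sp by simp
  from S.dimI[OF subf this] show ?thesis
    using bs distinct_card[of bs] by (simp add: hilbert_function_def scalars_def over_def)
qed

section \<open>Simplicial forms\<close>

lemma mdegree_superset:
  "finite A \<Longrightarrow> Poly_Mapping.keys a \<subseteq> A \<Longrightarrow> mdegree a = (\<Sum>v\<in>A. Poly_Mapping.lookup a v)"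
  unfolding mdegree_def by (rule sum.mono_neutral_left) (auto simp: in_keys_iff)

lemma mdegree_add: "mdegree (a + b) = mdegree a + mdegree b"
proof -
  let ?A = "Poly_Mapping.keys a \<union> Poly_Mapping.keys b"
  have "Poly_Mapping.keys (a + b) \<subseteq> ?A" by (rule keys_add)
  then show ?thesis
    by (simp add: mdegree_superset[of ?A] lookup_add sum.distrib)
qed

lemma mdegree_single [simp]: "mdegree (Poly_Mapping.single v n) = n"
  by (simp add: mdegree_def)

text \<open>The exponent vector of \<open>u\<^sub>S\<close>. For an infinite \<open>S\<close> the
  sum collapses to 0, whence the finiteness assumptions below.\<close>

definition umono :: "nat set \<Rightarrow> (pvar \<Rightarrow>\<^sub>0 nat)" where
  "umono S = (\<Sum>j\<in>S. Poly_Mapping.single (UVar j) (Suc 0))"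

abbreviation xmono :: "nat \<Rightarrow> (pvar \<Rightarrow>\<^sub>0 nat)" where
  "xmono i \<equiv> Poly_Mapping.single (XVar i) (Suc 0)"

lemma lookup_umono:
  "finite S \<Longrightarrow> Poly_Mapping.lookup (umono S) (UVar j) = (if j \<in> S then 1 else 0)"
  by (simp add: umono_def lookup_sum lookup_single when_def)

lemma lookup_umono_XVar [simp]: "Poly_Mapping.lookup (umono S) (XVar i) = 0"
  by (simp add: umono_def lookup_sum lookup_single when_def)

lemma umono_eq_iff: "finite S \<Longrightarrow> finite T \<Longrightarrow> umono S = umono T \<longleftrightarrow> S = T"
  by (metis lookup_umono one_neq_zero subsetI subset_antisym)

lemma mdegree_umono: "finite S \<Longrightarrow> mdegree (umono S) = card S"
  unfolding umono_def
  by (induction S rule: finite_induct) (simp_all add: mdegree_add mdegree_def[of 0])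

lemma umono_Un: "finite S \<Longrightarrow> finite T \<Longrightarrow> S \<inter> T = {} \<Longrightarrow> umono (S \<union> T) = umono S + umono T"
  unfolding umono_def by (rule sum.union_disjoint)

lemma umono_Diff: "finite S \<Longrightarrow> T \<subseteq> S \<Longrightarrow> umono (S - T) + umono T = umono S"
  by (subst umono_Un[symmetric]) (auto simp: finite_subset intro: arg_cong[of _ _ umono])

lemma keys_umono: "finite S \<Longrightarrow> Poly_Mapping.keys (umono S) = UVar ` S"
proof -
  assume S: "finite S"
  have "v \<in> Poly_Mapping.keys (umono S) \<longleftrightarrow> v \<in> UVar ` S" for v
    using S by (cases v) (auto simp: in_keys_iff lookup_umono)
  then show ?thesis by blast
qed

lemma prod_Var_UVar:
  "(\<Prod>j\<in>S. Var (UVar j)) = (Poly_Mapping.single (umono S) 1 :: (pvar, 'k::comm_ring_1) mpoly)"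
  unfolding umono_def
  by (induction S rule: infinite_finite_induct) (simp_all add: Var_def mult_single)

lemma xmono_eq_iff:
  assumes "xmono i + umono S = xmono k + umono T"
  shows "i = k \<and> umono S = umono T"
proof -
  have "Poly_Mapping.lookup (xmono i + umono S) (XVar i) = Poly_Mapping.lookup (xmono k + umono T) (XVar i)"
    using assms by simp
  then have "i = k" by (auto simp: lookup_add lookup_single when_def split: if_splits)
  with assms show ?thesis by simp
qed

text \<open>The relation is the binomial \<open>X^a - X^b\<close>, which is not the zero polynomial
  because \<open>a \<noteq> b\<close>.\<close>

lemma alg_dep_binomial:
  fixes g :: "'i \<Rightarrow> ('v, 'k::field) mpoly"
  assumes "Poly_Mapping.keys a \<subseteq> I" "Poly_Mapping.keys b \<subseteq> I" "a \<noteq> b"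
    and "(\<Prod>v\<in>Poly_Mapping.keys a. g v ^ Poly_Mapping.lookup a v) =
      (\<Prod>v\<in>Poly_Mapping.keys b. g v ^ Poly_Mapping.lookup b v)"
  shows "alg_dep_family I g"
proof -
  let ?P = "Poly_Mapping.single a 1 - Poly_Mapping.single b 1 :: ('i, 'k) mpoly"
  have lookup: "Poly_Mapping.lookup ?P c = (if c = a then 1 else if c = b then - 1 else 0)" for c
    using assms(3) by (auto simp: lookup_minus lookup_single when_def)
  have keys: "Poly_Mapping.keys ?P = {a, b}"
    by (auto simp: in_keys_iff lookup split: if_splits)
  have "?P \<in> polys_in I"
    using assms(1,2) by (simp only: polys_in_def mem_Collect_eq keys) simp
  moreover have "?P \<noteq> 0"
    using keys by force
  moreover have "subst g ?P = 0"
    unfolding subst_def keys using assms(3,4) by (simp add: lookup Const_def single_uminus)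
  ultimately show ?thesis unfolding alg_dep_family_def by blast
qed

text \<open>Distinct indices make the two quadratic monomials different, so the binomial criterion
  applies.\<close>

lemma alg_dep_of_product_relation:
  fixes g :: "'i \<Rightarrow> ('v, 'k::field) mpoly"
  assumes "{i, j, k, l} \<subseteq> I" "distinct [i, j, k, l]" "g i * g j = g k * g l"
  shows "alg_dep_family I g"
proof -
  let ?m = "\<lambda>x y. Poly_Mapping.single x (Suc 0) + Poly_Mapping.single y (Suc 0)"
  have keys: "Poly_Mapping.keys (?m x y) = {x, y}" if "x \<noteq> y" for x y :: 'i
    using that by (auto simp: in_keys_iff lookup_add lookup_single when_def split: if_splits)
  have "?m i j \<noteq> ?m k l"
    using keys[of i j] keys[of k l] assms(2) by (metis distinct_length_2_or_more insertCI insertE singletonD)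
  then show ?thesis
    using assms by (intro alg_dep_binomial[of "?m i j" I "?m k l"])
      (auto simp: keys lookup_add lookup_single when_def)
qed

text \<open>Here \<open>n\<close> is the common size of the facets; the additional
  \<open>x\<close>-variable gives the form degree \<open>Suc n\<close>.\<close>

locale facet_enumeration =
  fixes s m n :: nat and \<Delta> :: "nat set set" and Fc :: "nat \<Rightarrow> nat set"
  assumes complex: "simplicial_complex_on m \<Delta>"
    and card_facet: "\<And>S. S \<in> facets \<Delta> \<Longrightarrow> card S = n"
    and bij: "bij_betw Fc {1..s} (facets \<Delta>)"
begin

lemma finite_complex: "finite \<Delta>"
  using complex unfolding simplicial_complex_on_def by (meson finite_Pow_iff finite_atLeastAtMost finite_subset)

lemma face_subset: "S \<in> \<Delta> \<Longrightarrow> S \<subseteq> {1..m}"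
  using complex unfolding simplicial_complex_on_def by blast

lemma finite_face: "S \<in> \<Delta> \<Longrightarrow> finite S"
  using face_subset finite_subset by blast

lemma subface: "S \<in> \<Delta> \<Longrightarrow> T \<subseteq> S \<Longrightarrow> T \<in> \<Delta>"
  using complex unfolding simplicial_complex_on_def by blast

lemma Fc_face: "i \<in> {1..s} \<Longrightarrow> Fc i \<in> \<Delta>"
  using bij unfolding bij_betw_def facets_def by blast

lemma card_Fc: "i \<in> {1..s} \<Longrightarrow> card (Fc i) = n"
  using bij card_facet unfolding bij_betw_def by blast

lemma finite_Fc: "i \<in> {1..s} \<Longrightarrow> finite (Fc i)"
  using Fc_face finite_face by blast

lemma Fc_covers:
  assumes "S \<in> \<Delta>"
  obtains i where "i \<in> {1..s}" "S \<subseteq> Fc i"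
proof -
  have "finite {T \<in> \<Delta>. S \<subseteq> T}" "S \<in> {T \<in> \<Delta>. S \<subseteq> T}"
    using finite_complex assms by auto
  from finite_has_maximal2[OF this] obtain T where T: "T \<in> \<Delta>" "S \<subseteq> T"
    "\<forall>U\<in>{T \<in> \<Delta>. S \<subseteq> T}. T \<subseteq> U \<longrightarrow> T = U"
    by auto
  have "T \<in> facets \<Delta>"
    unfolding facets_def
  proof (intro CollectI conjI ballI impI)
    fix U assume "U \<in> \<Delta>" "T \<subseteq> U"
    with T show "T = U" by auto
  qed (rule T(1))
  then have "T \<in> Fc ` {1..s}" using bij unfolding bij_betw_def by simp
  with T(2) that show ?thesis by blast
qed

section \<open>The coefficients of the form of a pure complex\<close>

abbreviation F :: "(pvar, 'k::field) mpoly" where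
  "F \<equiv> simplicial_form s Fc"

abbreviation facet_mono :: "nat \<Rightarrow> (pvar \<Rightarrow>\<^sub>0 nat)" where
  "facet_mono i \<equiv> xmono i + umono (Fc i)"

lemma simplicial_form_eq: "F = (\<Sum>i=1..s. Poly_Mapping.single (facet_mono i) (1::'k::field))"
  unfolding simplicial_form_def prod_Var_UVar by (simp add: Var_def mult_single)

lemma lookup_simplicial_form:
  "Poly_Mapping.lookup (F :: (pvar, 'k::field) mpoly) e = (if e \<in> facet_mono ` {1..s} then 1 else 0)"
proof (cases "e \<in> facet_mono ` {1..s}")
  case True
  then obtain i where i: "i \<in> {1..s}" "e = facet_mono i" by blast
  have "Poly_Mapping.lookup (F :: (pvar, 'k) mpoly) e = (\<Sum>k=1..s. if k = i then 1 else 0)"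
    unfolding simplicial_form_eq lookup_sum
    by (intro sum.cong) (auto simp: i(2) lookup_single when_def dest: xmono_eq_iff)
  then show ?thesis using i True by simp
next
  case False
  then show ?thesis
    unfolding simplicial_form_eq lookup_sum
    by (auto simp: lookup_single when_def intro!: sum.neutral)
qed

lemma facet_mono_le_1: "i \<in> {1..s} \<Longrightarrow> Poly_Mapping.lookup (facet_mono i) v \<le> 1"
  by (cases v) (auto simp: lookup_add lookup_single when_def lookup_umono finite_Fc)

lemma squarefree_simplicial_form: "squarefree_form (F :: (pvar, 'k::field) mpoly)"
  unfolding squarefree_form_def lookup_simplicial_form using facet_mono_le_1 by auto

lemma facets_nonempty: "\<exists>i. i \<in> {1..s}"
proof -
  have "{} \<in> \<Delta>" using complex unfolding simplicial_complex_on_def by simp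
  then show ?thesis by (rule Fc_covers) blast
qed

lemma simplicial_form_nonzero: "F \<noteq> (0 :: (pvar, 'k::field) mpoly)"
proof
  assume *: "F = (0 :: (pvar, 'k) mpoly)"
  obtain i where "i \<in> {1..s}" using facets_nonempty by blast
  then show False
    using lookup_simplicial_form[where 'k = 'k, of "facet_mono i"] unfolding * by simp
qed

lemma mdegree_facet_mono: "i \<in> {1..s} \<Longrightarrow> mdegree (facet_mono i) = Suc n"
  by (simp add: mdegree_add mdegree_umono finite_Fc card_Fc)

lemma keys_xmono_umono:
  assumes "i \<in> {1..s}" "S \<subseteq> Fc i"
  shows "Poly_Mapping.keys (xmono i + umono S) \<subseteq> perazzo_vars s m"
proof -
  have "finite S" using assms finite_Fc finite_subset by blast
  then have "Poly_Mapping.keys (xmono i + umono S) \<subseteq> insert (XVar i) (UVar ` S)"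
    using keys_add[of "xmono i" "umono S"] by (simp add: keys_umono)
  also have "\<dots> \<subseteq> perazzo_vars s m"
    using assms face_subset[OF Fc_face[OF assms(1)]] by (auto simp: perazzo_vars_def)
  finally show ?thesis .
qed

text \<open>Only the monomial of facet \<open>k\<close> contains \<open>XVar k\<close>, so this
  operator sees one term of the form and leaves the complement of \<open>S\<close> in that
  facet.\<close>

lemma lookup_simplicial_form_xmono:
  assumes "k \<in> {1..s}" "S \<subseteq> Fc k"
  shows "Poly_Mapping.lookup (F :: (pvar, 'k::field) mpoly) (c + (xmono k + umono S)) =
    (if c = umono (Fc k - S) then 1 else 0)"
proof -
  have "c + (xmono k + umono S) \<in> facet_mono ` {1..s} \<longleftrightarrow> c = umono (Fc k - S)"
  proof
    assume "c + (xmono k + umono S) \<in> facet_mono ` {1..s}"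
    then obtain i where i: "i \<in> {1..s}" "c + (xmono k + umono S) = facet_mono i" by blast
    have "Poly_Mapping.lookup (c + (xmono k + umono S)) (XVar k) = Poly_Mapping.lookup (facet_mono i) (XVar k)"
      using i(2) by simp
    then have "i = k"
      by (auto simp: lookup_add lookup_single when_def split: if_splits)
    with i(2) have "c + umono S + xmono k = umono (Fc k - S) + umono S + xmono k"
      using umono_Diff[OF finite_Fc[OF assms(1)] assms(2)] by (simp add: ac_simps)
    then show "c = umono (Fc k - S)" by simp
  next
    assume "c = umono (Fc k - S)"
    then have "c + (xmono k + umono S) = xmono k + (umono (Fc k - S) + umono S)"
      by (simp add: ac_simps)
    then have "c + (xmono k + umono S) = facet_mono k"
      unfolding umono_Diff[OF finite_Fc[OF assms(1)] assms(2)] .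
    with assms(1) show "c + (xmono k + umono S) \<in> facet_mono ` {1..s}" by blast
  qed
  then show ?thesis by (simp add: lookup_simplicial_form)
qed

text \<open>The monomials that do not annihilate the form divide some facet monomial. Squarefreeness
  reduces such a divisor to a subset of the facet, with or without the
  \<open>x\<close>-variable.\<close>

lemma divisor_of_facet_mono:
  assumes "k \<in> {1..s}" "c + a = facet_mono k"
  obtains S where "S \<subseteq> Fc k" "a = umono S \<or> a = xmono k + umono S"
proof
  let ?S = "{j. Poly_Mapping.lookup a (UVar j) = Suc 0}"
  have sum: "Poly_Mapping.lookup c v + Poly_Mapping.lookup a v = Poly_Mapping.lookup (facet_mono k) v" for v
    using assms(2) by (metis lookup_add)
  have U: "Poly_Mapping.lookup c (UVar j) + Poly_Mapping.lookup a (UVar j) = (if j \<in> Fc k then 1 else 0)" for j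
    using sum[of "UVar j"] by (simp add: lookup_add lookup_single lookup_umono finite_Fc[OF assms(1)])
  have X: "Poly_Mapping.lookup c (XVar i) + Poly_Mapping.lookup a (XVar i) = (if i = k then 1 else 0)" for i
    using sum[of "XVar i"] by (auto simp: lookup_add lookup_single when_def)
  show S: "?S \<subseteq> Fc k"
  proof
    fix j assume "j \<in> ?S"
    then show "j \<in> Fc k" using U[of j] by (simp split: if_splits)
  qed
  have fin: "finite ?S" using S finite_Fc[OF assms(1)] finite_subset by blast
  have aU: "Poly_Mapping.lookup a (UVar j) = (if j \<in> ?S then 1 else 0)" for j
    using U[of j] by (auto split: if_splits)
  have aX: "i \<noteq> k \<Longrightarrow> Poly_Mapping.lookup a (XVar i) = 0" for i
    using X[of i] by simp
  have "a = Poly_Mapping.single (XVar k) (Poly_Mapping.lookup a (XVar k)) + umono ?S"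
  proof (rule poly_mapping_eqI)
    fix v
    show "Poly_Mapping.lookup a v = Poly_Mapping.lookup
        (Poly_Mapping.single (XVar k) (Poly_Mapping.lookup a (XVar k)) + umono ?S) v"
    proof (cases v)
      case (XVar i)
      then show ?thesis by (cases "i = k") (simp_all add: aX lookup_add lookup_single when_def)
    next
      case (UVar j)
      then show ?thesis using aU[of j] by (simp add: lookup_add lookup_single lookup_umono fin)
    qed
  qed
  moreover have "Poly_Mapping.lookup a (XVar k) = 0 \<or> Poly_Mapping.lookup a (XVar k) = Suc 0"
    using X[of k] by auto
  ultimately show "a = umono ?S \<or> a = xmono k + umono ?S"
    by (elim disjE) (simp_all only: single_zero add_0_left simp_thms)
qed

section \<open>Hilbert function, socle degree and the Perazzo property\<close>

definition num_faces :: "nat \<Rightarrow> nat" where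
  "num_faces k = card {S \<in> \<Delta>. card S = k}"

text \<open>A basis in degree \<open>i\<close>: the \<open>u\<^sub>S\<close> for the faces \<open>S\<close> of size \<open>i\<close>, and for every face \<open>T\<close> of
  size \<open>n + 1 - i\<close> one operator that takes \<open>F\<close> to \<open>u\<^sub>T\<close>.\<close>

theorem hilbert_function_simplicial_form:
  assumes "i \<le> Suc n"
  shows "hilbert_function (perazzo_vars s m) (F :: (pvar, 'k::field) mpoly) i =
    num_faces i + num_faces (Suc n - i)"
proof -
  have "\<forall>S\<in>\<Delta>. \<exists>i. i \<in> {1..s} \<and> S \<subseteq> Fc i"
  proof
    fix S assume "S \<in> \<Delta>"
    then show "\<exists>i. i \<in> {1..s} \<and> S \<subseteq> Fc i" by (rule Fc_covers) blast
  qed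
  from bchoice[OF this] obtain \<phi> where
    \<phi>: "\<And>S. S \<in> \<Delta> \<Longrightarrow> \<phi> S \<in> {1..s}" "\<And>S. S \<in> \<Delta> \<Longrightarrow> S \<subseteq> Fc (\<phi> S)"
    by blast
  \<comment> \<open>Every facet containing \<open>T\<close> yields an operator of this shape with
    the same effect, so \<open>\<phi>\<close> fixes one of them.\<close>
  define \<beta> where "\<beta> T = xmono (\<phi> T) + umono (Fc (\<phi> T) - T)" for T
  let ?\<A> = "{S \<in> \<Delta>. card S = i}" and ?\<B> = "{T \<in> \<Delta>. card T = Suc n - i}"
  let ?F = "F :: (pvar, 'k) mpoly"
  have lookup_\<beta>: "Poly_Mapping.lookup ?F (c + \<beta> T) = (if c = umono T then 1 else 0)" if "T \<in> \<Delta>" for c T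
    using lookup_simplicial_form_xmono[OF \<phi>(1)[OF that], of "Fc (\<phi> T) - T" c] \<phi>(2)[OF that]
    by (simp add: \<beta>_def double_diff)
  \<comment> \<open>Every monomial of the form contains an \<open>x\<close>-variable, so a product
    of two \<open>u\<close>-monomials is never among them.\<close>
  have no_X: "Poly_Mapping.lookup ?F (umono S + umono T) = 0" for S T
  proof -
    have "umono S + umono T \<noteq> facet_mono k" for k
    proof
      assume "umono S + umono T = facet_mono k"
      then have "Poly_Mapping.lookup (umono S + umono T) (XVar k) = Poly_Mapping.lookup (facet_mono k) (XVar k)"
        by simp
      then show False by (simp add: lookup_add)
    qed
    then show ?thesis by (auto simp: lookup_simplicial_form)
  qed
  have inj_u: "inj_on umono ?\<A>"
    by (rule inj_onI) (auto simp: umono_eq_iff finite_face)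
  have inj_\<beta>: "inj_on \<beta> ?\<B>"
  proof (rule inj_onI)
    fix T T' assume T: "T \<in> ?\<B>" "T' \<in> ?\<B>" "\<beta> T = \<beta> T'"
    then have "Poly_Mapping.lookup ?F (umono T + \<beta> T') = 1"
      using lookup_\<beta>[of T "umono T"] by simp
    then have "umono T = umono T'"
      using lookup_\<beta>[of T' "umono T"] T by (simp split: if_splits)
    then show "T = T'" using T by (simp add: umono_eq_iff finite_face)
  qed
  have disj: "umono ` ?\<A> \<inter> \<beta> ` ?\<B> = {}"
  proof safe
    fix S T assume ST: "umono S = \<beta> T"
    have "Poly_Mapping.lookup (umono S) (XVar (\<phi> T)) = Poly_Mapping.lookup (\<beta> T) (XVar (\<phi> T))"
      unfolding ST ..
    then show "umono S \<in> {}" by (simp add: \<beta>_def lookup_add)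
  qed
  have "hilbert_function (perazzo_vars s m) ?F i = card (umono ` ?\<A> \<union> \<beta> ` ?\<B>)"
  proof (rule hilbert_function_eq_card[OF squarefree_simplicial_form simplicial_form_nonzero])
    show "finite (umono ` ?\<A> \<union> \<beta> ` ?\<B>)"
      using finite_complex by simp
  next
    fix b assume "b \<in> umono ` ?\<A> \<union> \<beta> ` ?\<B>"
    then show "Poly_Mapping.keys b \<subseteq> perazzo_vars s m \<and> mdegree b = i"
    proof
      assume "b \<in> umono ` ?\<A>"
      then obtain S where S: "S \<in> \<Delta>" "card S = i" "b = umono S" by blast
      then show ?thesis
        using face_subset[OF S(1)] by (auto simp: keys_umono mdegree_umono finite_face perazzo_vars_def)
    next
      assume "b \<in> \<beta> ` ?\<B>"
      then obtain T where T: "T \<in> \<Delta>" "card T = Suc n - i" "b = \<beta> T" by blast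
      let ?k = "\<phi> T"
      have fin: "finite (Fc ?k - T)" using finite_Fc[OF \<phi>(1)[OF T(1)]] by simp
      have "card (Fc ?k - T) = n - (Suc n - i)"
        using card_Fc[OF \<phi>(1)[OF T(1)]] T \<phi>(2)[OF T(1)] finite_face[OF T(1)]
        by (simp add: card_Diff_subset)
      \<comment> \<open>This excludes \<open>i = 0\<close>, where the truncated subtraction above
        would give an operator of degree 1.\<close>
      moreover have "card T \<le> n"
        using card_mono[OF finite_Fc[OF \<phi>(1)] \<phi>(2)] card_Fc[OF \<phi>(1)] T(1) by metis
      ultimately have "mdegree b = i"
        using T(2) assms unfolding T(3) \<beta>_def by (simp add: mdegree_add mdegree_umono fin)
      moreover have "Poly_Mapping.keys b \<subseteq> perazzo_vars s m"
        using keys_xmono_umono[OF \<phi>(1)[OF T(1)]] unfolding T(3) \<beta>_def by simp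
      ultimately show ?thesis by simp
    qed
  next
    fix a :: "pvar \<Rightarrow>\<^sub>0 nat"
    assume a: "mdegree a = i"
    show "(\<forall>c. Poly_Mapping.lookup ?F (c + a) = 0) \<or>
      (\<exists>b\<in>umono ` ?\<A> \<union> \<beta> ` ?\<B>. \<forall>c. Poly_Mapping.lookup ?F (c + a) = Poly_Mapping.lookup ?F (c + b))"
    proof (rule disj_imp[THEN iffD2, rule_format])
      assume "\<not> (\<forall>c. Poly_Mapping.lookup ?F (c + a) = 0)"
      then obtain c k where k: "k \<in> {1..s}" "c + a = facet_mono k"
        unfolding lookup_simplicial_form by (auto split: if_splits)
      then obtain S where S: "S \<subseteq> Fc k" "a = umono S \<or> a = xmono k + umono S"
        using divisor_of_facet_mono by metis
      have fin: "finite S" using S(1) finite_Fc[OF k(1)] finite_subset by blast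
      from S(2) show "\<exists>b\<in>umono ` ?\<A> \<union> \<beta> ` ?\<B>. \<forall>c. Poly_Mapping.lookup ?F (c + a) = Poly_Mapping.lookup ?F (c + b)"
      proof
        assume "a = umono S"
        moreover from this have "card S = i" using a by (simp add: mdegree_umono fin)
        moreover have "S \<in> \<Delta>" using subface[OF Fc_face[OF k(1)] S(1)] .
        ultimately show ?thesis by blast
      next
        assume aS: "a = xmono k + umono S"
        \<comment> \<open>The operator \<open>a\<close> has the same effect as the operator chosen
          for \<open>?T\<close>, although \<open>k\<close> may differ from
          \<open>\<phi> ?T\<close>.\<close>
        let ?T = "Fc k - S"
        have "Suc (card S) = i" using a aS by (simp add: mdegree_add mdegree_umono fin)
        then have "card ?T = Suc n - i"
          using card_Diff_subset[OF fin S(1)] card_Fc[OF k(1)] by auto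
        moreover have T: "?T \<in> \<Delta>" using subface[OF Fc_face[OF k(1)]] by blast
        ultimately have "\<beta> ?T \<in> \<beta> ` ?\<B>" by blast
        moreover have "Poly_Mapping.lookup ?F (c + a) = Poly_Mapping.lookup ?F (c + \<beta> ?T)" for c
          unfolding aS lookup_\<beta>[OF T] lookup_simplicial_form_xmono[OF k(1) S(1)] ..
        ultimately show ?thesis by blast
      qed
    qed
  next
    fix b assume "b \<in> umono ` ?\<A> \<union> \<beta> ` ?\<B>"
    then show "\<exists>c. Poly_Mapping.lookup ?F (c + b) \<noteq> 0 \<and>
      (\<forall>b'\<in>umono ` ?\<A> \<union> \<beta> ` ?\<B> - {b}. Poly_Mapping.lookup ?F (c + b') = 0)"
    proof
      assume "b \<in> umono ` ?\<A>"
      then obtain S where S: "S \<in> \<Delta>" "b = umono S" by blast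
      \<comment> \<open>The exponents \<open>umono S\<close> and \<open>\<beta> S\<close> add up to
        a facet monomial, so each serves to separate the other.\<close>
      let ?k = "\<phi> S" and ?c = "\<beta> S"
      have "Poly_Mapping.lookup ?F (?c + b) \<noteq> 0"
        using lookup_\<beta>[OF S(1), of b] S(2) by (simp add: add.commute)
      moreover have "Poly_Mapping.lookup ?F (?c + umono S') = 0" if "umono S' \<noteq> b" for S'
        using lookup_\<beta>[OF S(1), of "umono S'"] that S(2) by (simp add: add.commute)
      moreover have "Poly_Mapping.lookup ?F (?c + \<beta> T) = 0" if "T \<in> \<Delta>" for T
      proof -
        have "?c \<noteq> umono T"
        proof
          assume "?c = umono T"
          then have "Poly_Mapping.lookup ?c (XVar ?k) = 0" by simp
          then show False by (simp add: \<beta>_def lookup_add)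
        qed
        then show ?thesis by (simp add: lookup_\<beta>[OF that])
      qed
      ultimately show ?thesis by (intro exI[of _ ?c]) auto
    next
      assume "b \<in> \<beta> ` ?\<B>"
      then obtain T where T: "T \<in> \<Delta>" "b = \<beta> T" by blast
      have "Poly_Mapping.lookup ?F (umono T + b) \<noteq> 0"
        by (simp add: T(2) lookup_\<beta>[OF T(1)])
      moreover have "Poly_Mapping.lookup ?F (umono T + \<beta> T') = 0" if "T' \<in> \<Delta>" "\<beta> T' \<noteq> b" for T'
        using that T by (auto simp: lookup_\<beta> umono_eq_iff finite_face)
      ultimately show ?thesis
        using no_X by (intro exI[of _ "umono T"]) auto
    qed
  qed
  also have "\<dots> = card ?\<A> + card ?\<B>"
    using finite_complex disj inj_u inj_\<beta> by (simp add: card_Un_disjoint card_image)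
  finally show ?thesis by (simp add: num_faces_def)
qed

text \<open>The zero polynomial is homogeneous of every degree, so zero lies in each component; any
  further class is detected by a nonzero contraction.\<close>

lemma graded_component_nontrivial_iff:
  "graded_component (perazzo_vars s m) (F :: (pvar, 'k::field) mpoly) i \<noteq>
     {\<zero>\<^bsub>macaulay_algebra (perazzo_vars s m) (F :: (pvar, 'k) mpoly)\<^esub>} \<longleftrightarrow>
   (\<exists>g \<in> polys_in (perazzo_vars s m). homogeneous i g \<and> (\<exists>c. contract (F :: (pvar, 'k) mpoly) g c \<noteq> 0))"
proof -
  let ?V = "perazzo_vars s m" and ?F = "F :: (pvar, 'k) mpoly"
  note zero = residue_class_eq_zero_iff[OF squarefree_simplicial_form[where 'k = 'k], of _ ?V]
  have "residue_class ?V ?F 0 = \<zero>\<^bsub>macaulay_algebra ?V ?F\<^esub>"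
    using zero[OF polys_in_zero] by (simp add: mem_ann_iff[OF squarefree_simplicial_form] polys_in_zero)
  moreover have "homogeneous i 0" by (simp add: homogeneous_def)
  ultimately have "\<zero>\<^bsub>macaulay_algebra ?V ?F\<^esub> \<in> graded_component ?V ?F i"
    unfolding graded_component_def using polys_in_zero by (metis (mono_tags, lifting) image_eqI mem_Collect_eq)
  then have "graded_component ?V ?F i \<noteq> {\<zero>\<^bsub>macaulay_algebra ?V ?F\<^esub>} \<longleftrightarrow>
      (\<exists>g \<in> polys_in ?V. homogeneous i g \<and> residue_class ?V ?F g \<noteq> \<zero>\<^bsub>macaulay_algebra ?V ?F\<^esub>)"
    unfolding graded_component_def by auto
  then show ?thesis
    using zero by (auto simp: mem_ann_iff[OF squarefree_simplicial_form])
qed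

text \<open>A facet monomial takes the form to a nonzero constant, and an operator that does not
  annihilate the form has a monomial dividing a facet monomial, whose degree is
  \<open>Suc n\<close>.\<close>

lemma socle_degree_simplicial_form:
  "socle_degree (perazzo_vars s m) (F :: (pvar, 'k::field) mpoly) = Suc n"
  unfolding socle_degree_def graded_component_nontrivial_iff
proof (rule Greatest_equality)
  obtain i where i: "i \<in> {1..s}" using facets_nonempty by blast
  let ?g = "Poly_Mapping.single (facet_mono i) 1 :: (pvar, 'k) mpoly"
  have "contract F ?g 0 \<noteq> 0"
    using i by (simp add: contract_single lookup_simplicial_form)
  moreover have "?g \<in> polys_in (perazzo_vars s m)"
    using keys_xmono_umono[OF i order_refl] by (rule polys_in_single)
  moreover have "homogeneous (Suc n) ?g"
    using mdegree_facet_mono[OF i] by (simp add: homogeneous_def)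
  ultimately show "\<exists>g \<in> polys_in (perazzo_vars s m). homogeneous (Suc n) g \<and>
      (\<exists>c. contract (F :: (pvar, 'k) mpoly) g c \<noteq> 0)"
    by blast
next
  fix d assume "\<exists>g \<in> polys_in (perazzo_vars s m). homogeneous d g \<and>
      (\<exists>c. contract (F :: (pvar, 'k) mpoly) g c \<noteq> 0)"
  then obtain g :: "(pvar, 'k) mpoly" and c where g: "homogeneous d g" "contract F g c \<noteq> 0" by blast
  then obtain a where a: "a \<in> Poly_Mapping.keys g" "Poly_Mapping.lookup (F :: (pvar, 'k) mpoly) (c + a) \<noteq> 0"
    unfolding contract_def by (elim sum.not_neutral_contains_not_neutral) auto
  then obtain k where "k \<in> {1..s}" "c + a = facet_mono k"
    unfolding lookup_simplicial_form by (auto split: if_splits)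
  then have "mdegree c + mdegree a = Suc n"
    using mdegree_facet_mono mdegree_add by metis
  then show "d \<le> Suc n"
    using g(1) a(1) unfolding homogeneous_def by auto
qed

text \<open>Distinct facets have distinct monomials, which yields linear independence; the summand
  \<open>g0\<close> is taken to be 0.\<close>

lemma perazzo_form_simplicial_form:
  assumes "alg_dep_family {1..s} (\<lambda>i. \<Prod>j\<in>Fc i. Var (UVar j) :: (pvar, 'k::field) mpoly)"
  shows "perazzo_form s m (F :: (pvar, 'k) mpoly)"
proof -
  let ?g = "\<lambda>i. \<Prod>j\<in>Fc i. Var (UVar j) :: (pvar, 'k) mpoly"
  have "homogeneous (Suc n) (F :: (pvar, 'k) mpoly)"
    unfolding homogeneous_def
  proof
    fix a assume "a \<in> Poly_Mapping.keys (F :: (pvar, 'k) mpoly)"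
    then show "mdegree a = Suc n"
      unfolding in_keys_iff lookup_simplicial_form
      using mdegree_facet_mono by (auto split: if_splits)
  qed
  moreover have "?g i \<in> polys_in (UVar ` {1..m})" if "i \<in> {1..s}" for i
    using face_subset[OF Fc_face[OF that]] by (intro polys_in_prod polys_in_Var) auto
  moreover have "F = (\<Sum>i=1..s. Var (XVar i) * ?g i) + 0"
    unfolding simplicial_form_def by simp
  moreover have "lin_indep_family {1..s} ?g"
    unfolding lin_indep_family_def
  proof (intro allI impI ballI)
    fix c :: "nat \<Rightarrow> 'k" and k
    assume c: "(\<Sum>i=1..s. Const (c i) * ?g i) = 0" and k: "k \<in> {1..s}"
    have "Fc i = Fc k \<longleftrightarrow> i = k" if "i \<in> {1..s}" for i
      using bij that k unfolding bij_betw_def inj_on_def by blast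
    then have "Poly_Mapping.lookup (Const (c i) * ?g i) (umono (Fc k)) = (if i = k then c k else 0)"
      if "i \<in> {1..s}" for i
      using that k unfolding lookup_Const_mult prod_Var_UVar
      by (auto simp: lookup_single when_def umono_eq_iff finite_Fc)
    then have "Poly_Mapping.lookup (\<Sum>i=1..s. Const (c i) * ?g i) (umono (Fc k)) =
        (\<Sum>i=1..s. if i = k then c k else 0)"
      unfolding lookup_sum by (intro sum.cong) auto
    then show "c k = 0" using c k by simp
  qed
  ultimately show ?thesis
    unfolding perazzo_form_def using assms polys_in_zero
    by (intro conjI exI[of _ "Suc n"] exI[of _ ?g] exI[of _ 0] ballI) blast+
qed

lemma form_of_complex_simplicial_form: "form_of_complex s m \<Delta> (F :: (pvar, 'k::field) mpoly)"
  unfolding form_of_complex_def pure_complex_def using complex card_facet bij by auto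

end

section \<open>A weighted binomial identity and its perturbation\<close>

text \<open>By Pascal's rule each entry of row \<open>n\<close> up to \<open>j\<close> is counted
  twice, except the last one.\<close>

lemma sum_choose_Suc_row:
  "(\<Sum>i\<le>j. Suc n choose i) + (n choose j) = 2 * (\<Sum>i\<le>j. n choose i)"
  by (induction j) auto

text \<open>Passing from \<open>N\<close> to \<open>Suc N\<close> doubles the left side: the new
  entry at \<open>s = 0\<close> cancels the defect in \<open>sum_choose_Suc_row\<close>.\<close>

lemma sum_power_2_choose:
  "(\<Sum>s\<le>N. 2 ^ s * (N - s choose j)) + (\<Sum>i\<le>j. Suc N choose i) = 2 ^ Suc N"
proof (induction N)
  case 0
  have "(\<Sum>i\<le>j. Suc 0 choose i) + (0 choose j) = 2"
    by (induction j) auto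
  then show ?case by simp
next
  case (Suc N)
  have "(\<Sum>s\<le>Suc N. 2 ^ s * (Suc N - s choose j)) =
      (Suc N choose j) + 2 * (\<Sum>s\<le>N. 2 ^ s * (N - s choose j))"
    by (simp add: sum.atMost_Suc_shift sum_distrib_left mult.assoc del: sum.atMost_Suc)
  then show ?case
    using Suc.IH sum_choose_Suc_row[of "Suc N" j] by simp
qed

lemma sum_power_2_choose_symmetric:
  assumes "j \<le> N"
  shows "(\<Sum>s\<le>N. 2 ^ s * ((N - s choose j) + (N - s choose (N - j)))) = 2 ^ Suc N"
proof -
  have "(\<Sum>i\<le>N - j. Suc N choose i) = (\<Sum>i\<in>{Suc j..Suc N}. Suc N choose i)"
    using assms
    by (intro sum.reindex_bij_witness[of _ "\<lambda>i. Suc N - i" "\<lambda>i. Suc N - i"])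
      (auto intro: binomial_symmetric binomial_symmetric[symmetric])
  moreover have "(\<Sum>i\<le>j. Suc N choose i) + (\<Sum>i\<in>{Suc j..Suc N}. Suc N choose i) = (\<Sum>i\<le>Suc N. Suc N choose i)"
  proof -
    have "{..Suc N} = {..j} \<union> {Suc j..Suc N}" using assms by auto
    then show ?thesis by (simp only:) (subst sum.union_disjoint, auto)
  qed
  ultimately have "(\<Sum>i\<le>j. Suc N choose i) + (\<Sum>i\<le>N - j. Suc N choose i) = 2 ^ Suc N"
    by (simp only: choose_row_sum)
  with sum_power_2_choose[of N j] sum_power_2_choose[of N "N - j"] show ?thesis
    by (simp add: distrib_left sum.distrib)
qed

text \<open>The last equation contains only the last unknown; subtracting its contribution from the
  others leaves a smaller system of the same shape.\<close>

lemma unitriangular_solve: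
  fixes M :: "nat \<Rightarrow> nat \<Rightarrow> int"
  assumes "\<And>p. p < q \<Longrightarrow> M p p = 1" "\<And>p j. p < q \<Longrightarrow> j < q \<Longrightarrow> p < j \<Longrightarrow> M p j = 0"
  shows "\<exists>z. \<forall>j<q. (\<Sum>p<q. z p * M p j) = w j"
  using assms
proof (induction q arbitrary: w)
  case (Suc q)
  have "\<exists>z. \<forall>j<q. (\<Sum>p<q. z p * M p j) = w j - w q * M q j"
    by (rule Suc.IH) (use Suc.prems in auto)
  then obtain z where z: "\<And>j. j < q \<Longrightarrow> (\<Sum>p<q. z p * M p j) = w j - w q * M q j"
    by blast
  have "(\<Sum>p<Suc q. (z(q := w q)) p * M p j) = w j" if "j < Suc q" for j
  proof -
    have *: "(\<Sum>p<Suc q. (z(q := w q)) p * M p j) = (\<Sum>p<q. z p * M p j) + w q * M q j"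
      by simp
    show ?thesis
    proof (cases "j = q")
      case True
      have "(\<Sum>p<q. z p * M p q) = 0"
        using Suc.prems(2) by (intro sum.neutral) auto
      then show ?thesis using True Suc.prems(1) unfolding * by simp
    qed (use that z * in simp)
  qed
  then show ?case by blast
qed simp

text \<open>The weights \<open>2 ^ s\<close> give the same value for all \<open>j\<close>; by triangularity of the rows
  \<open>s = N - p\<close> with \<open>p < q\<close>, adding small integers to a large multiple of them realizes any
  deviation.\<close>

lemma weights_with_prescribed_deviation:
  fixes w :: "nat \<Rightarrow> int"
  assumes "2 * Q \<le> N"
  obtains c :: "nat \<Rightarrow> nat" and C :: int where "\<And>s. 0 < c s"
    "\<And>j. j \<le> Q \<Longrightarrow> int (\<Sum>s\<le>N. c s * ((N - s choose j) + (N - s choose (N - j)))) = C + 2 * w j"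
proof -
  define M where "M p j = int ((p choose j) + (p choose (N - j)))" for p j
  \<comment> \<open>The diagonal entry of row \<open>Q\<close> is 2 if \<open>2 * Q = N\<close>,
    where both binomials are 1, and 1 otherwise. Doubling the deviations keeps the solution
    integral.\<close>
  define y where "y = (if 2 * Q = N then w Q else 2 * w Q)"
  have y: "y * M Q Q = 2 * w Q"
    using assms by (auto simp: y_def M_def)
  have M0: "M p j = 0" and M1: "M p p = 1" if "p < Q" "j \<le> Q" "p < j" for p j
  proof -
    \<comment> \<open>For rows \<open>p < Q\<close> the mirrored binomial vanishes, which leaves a
      unitriangular matrix.\<close>
    have "p < N - j" "p < N - p" using that assms by auto
    then show "M p j = 0" "M p p = 1" using that by (simp_all add: M_def binomial_eq_0)
  qed
  have "\<exists>z. \<forall>j<Q. (\<Sum>p<Q. z p * M p j) = 2 * w j - y * M Q j"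
    by (rule unitriangular_solve) (auto intro: M0 M1[of _ Q])
  then obtain z where z: "\<And>j. j < Q \<Longrightarrow> (\<Sum>p<Q. z p * M p j) = 2 * w j - y * M Q j"
    by blast
  define x where "x = z(Q := y)"
  have x: "(\<Sum>p\<le>Q. x p * M p j) = 2 * w j" if "j \<le> Q" for j
  proof -
    have *: "(\<Sum>p\<le>Q. x p * M p j) = (\<Sum>p<Q. z p * M p j) + y * M Q j"
      by (simp add: x_def lessThan_Suc_atMost[symmetric])
    show ?thesis
    proof (cases "j = Q")
      case True
      have "(\<Sum>p<Q. z p * M p Q) = 0"
        by (intro sum.neutral) (auto simp: M0)
      then show ?thesis using True y unfolding * by simp
    qed (use that z * in simp)
  qed
  \<comment> \<open>\<open>B\<close> exceeds every \<open>\<bar>x p\<bar>\<close>, so all weights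
    are positive and \<open>nat\<close> loses nothing.\<close>
  define B where "B = 1 + (\<Sum>p\<le>Q. \<bar>x p\<bar>)"
  define c where "c s = nat (B * 2 ^ s + (if N - s \<le> Q then x (N - s) else 0))" for s
  have B1: "1 \<le> B" unfolding B_def by (simp add: sum_nonneg)
  have pos: "0 < B * 2 ^ s + (if N - s \<le> Q then x (N - s) else 0)" for s
  proof -
    have "B \<le> B * 2 ^ s" using B1 by simp
    moreover have "\<bar>x p\<bar> < B" if "p \<le> Q" for p
      unfolding B_def using that member_le_sum[of p "{..Q}" "\<lambda>p. \<bar>x p\<bar>"] by simp
    ultimately have "N - s \<le> Q \<Longrightarrow> \<bar>x (N - s)\<bar> < B * 2 ^ s" by (meson less_le_trans)
    then show ?thesis using B1 by (auto simp: abs_less_iff)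
  qed
  have c: "int (c s) = B * 2 ^ s + (if N - s \<le> Q then x (N - s) else 0)" for s
    using pos[of s] by (simp add: c_def)
  show ?thesis
  proof (rule that[of c "B * 2 ^ Suc N"])
    show "0 < c s" for s using pos[of s] by (simp add: c_def)
    fix j assume j: "j \<le> Q"
    have "int (\<Sum>s\<le>N. c s * ((N - s choose j) + (N - s choose (N - j)))) = (\<Sum>s\<le>N. int (c s) * M (N - s) j)"
      by (simp add: M_def)
    also have "\<dots> = B * (\<Sum>s\<le>N. 2 ^ s * M (N - s) j) +
        (\<Sum>s\<le>N. if N - s \<le> Q then x (N - s) * M (N - s) j else 0)"
      unfolding c sum_distrib_left sum.distrib[symmetric]
      by (intro sum.cong) (auto simp: algebra_simps)
    also have "(\<Sum>s\<le>N. 2 ^ s * M (N - s) j) = 2 ^ Suc N"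
    proof -
      have "(\<Sum>s\<le>N. 2 ^ s * M (N - s) j) =
          int (\<Sum>s\<le>N. 2 ^ s * ((N - s choose j) + (N - s choose (N - j))))"
        by (simp add: M_def)
      also have "\<dots> = int (2 ^ Suc N)"
        using j assms by (subst sum_power_2_choose_symmetric) auto
      finally show ?thesis by simp
    qed
    also have "(\<Sum>s\<le>N. if N - s \<le> Q then x (N - s) * M (N - s) j else 0) =
        (\<Sum>s | s \<le> N \<and> N - s \<le> Q. x (N - s) * M (N - s) j)"
      by (simp add: sum.inter_filter[symmetric])
    also have "\<dots> = (\<Sum>p\<le>Q. x p * M p j)"
      using assms by (intro sum.reindex_bij_witness[of _ "\<lambda>p. N - p" "\<lambda>s. N - s"]) auto
    finally show "int (\<Sum>s\<le>N. c s * ((N - s choose j) + (N - s choose (N - j)))) =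
        B * 2 ^ Suc N + 2 * w j"
      using x[OF j] by simp
  qed
qed

section \<open>Growth of the face numbers\<close>

text \<open>The number of faces with \<open>k\<close> vertices of the join of \<open>n\<close> discrete sets, the first \<open>r\<close> of
  which have \<open>t\<close> elements and the other ones a single element.\<close>

definition join_faces :: "nat \<Rightarrow> nat \<Rightarrow> nat \<Rightarrow> nat \<Rightarrow> nat" where
  "join_faces n r t k = (\<Sum>L | L \<subseteq> {..<n} \<and> card L = k. t ^ card (L \<inter> {..<r}))"

text \<open>Complements turn these sets into the subsets of \<open>{r..<n}\<close> with
  \<open>n - k\<close> elements.\<close>

lemma card_supersets:
  assumes "k \<le> n" "r \<le> n"
  shows "card {L. L \<subseteq> {..<n} \<and> card L = k \<and> {..<r} \<subseteq> L} = (n - r choose (n - k))"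
proof -
  have "bij_betw (\<lambda>L. {..<n} - L) {L. L \<subseteq> {..<n} \<and> card L = k \<and> {..<r} \<subseteq> L}
      {K. K \<subseteq> {r..<n} \<and> card K = n - k}"
  proof (rule bij_betwI[where g = "\<lambda>K. {..<n} - K"])
    show "(\<lambda>L. {..<n} - L) \<in> {L. L \<subseteq> {..<n} \<and> card L = k \<and> {..<r} \<subseteq> L} \<rightarrow>
        {K. K \<subseteq> {r..<n} \<and> card K = n - k}"
    proof
      fix L assume "L \<in> {L. L \<subseteq> {..<n} \<and> card L = k \<and> {..<r} \<subseteq> L}"
      then have L: "L \<subseteq> {..<n}" "card L = k" "{..<r} \<subseteq> L" by auto
      have "card ({..<n} - L) = n - k"
        using L(1,2) by (simp add: card_Diff_subset finite_subset)
      moreover have "{..<n} - L \<subseteq> {r..<n}"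
      proof
        fix x assume x: "x \<in> {..<n} - L"
        then have "\<not> x < r" using L(3) by blast
        then show "x \<in> {r..<n}" using x by simp
      qed
      ultimately show "{..<n} - L \<in> {K. K \<subseteq> {r..<n} \<and> card K = n - k}" by blast
    qed
    show "(\<lambda>K. {..<n} - K) \<in> {K. K \<subseteq> {r..<n} \<and> card K = n - k} \<rightarrow>
        {L. L \<subseteq> {..<n} \<and> card L = k \<and> {..<r} \<subseteq> L}"
    proof
      fix K assume "K \<in> {K. K \<subseteq> {r..<n} \<and> card K = n - k}"
      then have K: "K \<subseteq> {r..<n}" "card K = n - k" by auto
      then have Kn: "K \<subseteq> {..<n}" by auto
      have "card ({..<n} - K) = k"
        using K(2) Kn assms(1) by (simp add: card_Diff_subset finite_subset)
      moreover have "{..<r} \<subseteq> {..<n} - K"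
        using K(1) assms(2) by auto
      ultimately show "{..<n} - K \<in> {L. L \<subseteq> {..<n} \<and> card L = k \<and> {..<r} \<subseteq> L}" by blast
    qed
  qed auto
  then have "card {L. L \<subseteq> {..<n} \<and> card L = k \<and> {..<r} \<subseteq> L} =
      card {K. K \<subseteq> {r..<n} \<and> card K = n - k}"
    by (rule bij_betw_same_card)
  then show ?thesis
    by (simp add: n_subsets)
qed

text \<open>The sets \<open>L\<close> containing all \<open>r\<close> large parts contribute
  \<open>t ^ r\<close> each; the others, at most \<open>2 ^ n\<close> of them, miss a large part and
  contribute at most \<open>t ^ (r - 1)\<close>.\<close>

lemma join_faces_bounds:
  assumes "k \<le> n" "r \<le> n" "0 < r" "0 < t"
  shows "t ^ r * (n - r choose (n - k)) \<le> join_faces n r t k"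
    and "join_faces n r t k \<le> t ^ r * (n - r choose (n - k)) + 2 ^ n * t ^ (r - 1)"
proof -
  let ?A = "{L. L \<subseteq> {..<n} \<and> card L = k \<and> {..<r} \<subseteq> L}"
  let ?B = "{L. L \<subseteq> {..<n} \<and> card L = k \<and> \<not> {..<r} \<subseteq> L}"
  have fin: "finite ?A" "finite ?B" by auto
  have "{L. L \<subseteq> {..<n} \<and> card L = k} = ?A \<union> ?B" "?A \<inter> ?B = {}" by auto
  then have "join_faces n r t k = (\<Sum>L\<in>?A. t ^ card (L \<inter> {..<r})) + (\<Sum>L\<in>?B. t ^ card (L \<inter> {..<r}))"
    unfolding join_faces_def using fin by (simp add: sum.union_disjoint)
  also have "(\<Sum>L\<in>?A. t ^ card (L \<inter> {..<r})) = (\<Sum>L\<in>?A. t ^ r)"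
    by (intro sum.cong) (auto simp: Int_absorb1)
  also have "\<dots> = t ^ r * (n - r choose (n - k))"
    using card_supersets[OF assms(1,2)] by simp
  finally have eq: "join_faces n r t k =
      t ^ r * (n - r choose (n - k)) + (\<Sum>L\<in>?B. t ^ card (L \<inter> {..<r}))" .
  then show "t ^ r * (n - r choose (n - k)) \<le> join_faces n r t k" by simp
  have "(\<Sum>L\<in>?B. t ^ card (L \<inter> {..<r})) \<le> (\<Sum>L\<in>?B. t ^ (r - 1))"
  proof (intro sum_mono power_increasing)
    fix L assume "L \<in> ?B"
    then have "L \<inter> {..<r} \<subset> {..<r}" by blast
    from psubset_card_mono[OF finite_lessThan this] have "card (L \<inter> {..<r}) < r" by simp
    then show "card (L \<inter> {..<r}) \<le> r - 1" by simp
  qed (use assms in simp)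
  also have "\<dots> = card ?B * t ^ (r - 1)" by simp
  also have "card ?B \<le> card (Pow {..<n})" by (intro card_mono) auto
  also have "card (Pow {..<n}) = 2 ^ n" by (simp add: card_Pow)
  finally show "join_faces n r t k \<le> t ^ r * (n - r choose (n - k)) + 2 ^ n * t ^ (r - 1)"
    unfolding eq by simp
qed

text \<open>Scaling the number of copies by \<open>t ^ (N - s)\<close> makes all summands grow like \<open>t ^ Suc N\<close>.\<close>

lemma weighted_join_faces_bounds:
  fixes c :: "nat \<Rightarrow> nat"
  assumes "k \<le> Suc N" "0 < t"
  shows "t ^ Suc N * (\<Sum>s\<le>N. c s * (N - s choose (Suc N - k))) \<le>
      (\<Sum>s\<le>N. c s * t ^ (N - s) * join_faces (Suc N) (Suc s) t k)"
    and "(\<Sum>s\<le>N. c s * t ^ (N - s) * join_faces (Suc N) (Suc s) t k) \<le>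
      t ^ Suc N * (\<Sum>s\<le>N. c s * (N - s choose (Suc N - k))) + t ^ N * (2 ^ Suc N * (\<Sum>s\<le>N. c s))"
proof -
  have pow: "t ^ (N - s) * t ^ Suc s = t ^ Suc N" "t ^ (N - s) * t ^ s = t ^ N" if "s \<le> N" for s
    using that by (simp_all flip: power_add)
  have lower: "t ^ Suc N * (c s * (N - s choose (Suc N - k))) \<le>
      c s * t ^ (N - s) * join_faces (Suc N) (Suc s) t k" if "s \<le> N" for s
  proof -
    have "c s * t ^ (N - s) * (t ^ Suc s * (N - s choose (Suc N - k))) \<le>
        c s * t ^ (N - s) * join_faces (Suc N) (Suc s) t k"
      using join_faces_bounds(1)[of k "Suc N" "Suc s" t] assms that by (intro mult_left_mono) auto
    also have "c s * t ^ (N - s) * (t ^ Suc s * (N - s choose (Suc N - k))) =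
        (t ^ (N - s) * t ^ Suc s) * (c s * (N - s choose (Suc N - k)))"
      by (simp only: ac_simps)
    finally show ?thesis unfolding pow[OF that] .
  qed
  then show "t ^ Suc N * (\<Sum>s\<le>N. c s * (N - s choose (Suc N - k))) \<le>
      (\<Sum>s\<le>N. c s * t ^ (N - s) * join_faces (Suc N) (Suc s) t k)"
    unfolding sum_distrib_left by (intro sum_mono) auto
  have upper: "c s * t ^ (N - s) * join_faces (Suc N) (Suc s) t k \<le>
      t ^ Suc N * (c s * (N - s choose (Suc N - k))) + t ^ N * (2 ^ Suc N * c s)" if "s \<le> N" for s
  proof -
    have "c s * t ^ (N - s) * join_faces (Suc N) (Suc s) t k \<le>
        c s * t ^ (N - s) * (t ^ Suc s * (N - s choose (Suc N - k)) + 2 ^ Suc N * t ^ s)"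
      using join_faces_bounds(2)[of k "Suc N" "Suc s" t] assms that by (intro mult_left_mono) auto
    also have "\<dots> = (t ^ (N - s) * t ^ Suc s) * (c s * (N - s choose (Suc N - k))) +
        (t ^ (N - s) * t ^ s) * (2 ^ Suc N * c s)"
      by (simp only: distrib_left ac_simps)
    finally show ?thesis unfolding pow[OF that] .
  qed
  then show "(\<Sum>s\<le>N. c s * t ^ (N - s) * join_faces (Suc N) (Suc s) t k) \<le>
      t ^ Suc N * (\<Sum>s\<le>N. c s * (N - s choose (Suc N - k))) + t ^ N * (2 ^ Suc N * (\<Sum>s\<le>N. c s))"
    unfolding sum_distrib_left sum.distrib[symmetric] by (intro sum_mono) auto
qed

text \<open>The deviation prescribed for \<open>k = Suc j\<close> is the position of
  \<open>k\<close> in the permutation, so the leading coefficients increase along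
  \<open>\<pi>\<close>; a large \<open>t\<close> lets them decide the order.\<close>

lemma unconstrained_weighted_join_faces:
  fixes \<pi> :: "nat \<Rightarrow> nat"
  assumes "\<pi> permutes {1..Suc Q}" "2 * Q \<le> N"
  obtains c :: "nat \<Rightarrow> nat" and t where "\<And>s. 0 < c s" "2 \<le> t"
    "strict_mono_on {1..Suc Q} (\<lambda>i. (\<lambda>k. (\<Sum>s\<le>N. c s * t ^ (N - s) * join_faces (Suc N) (Suc s) t k) +
       (\<Sum>s\<le>N. c s * t ^ (N - s) * join_faces (Suc N) (Suc s) t (N + 2 - k))) (\<pi> i))"
proof -
  obtain c :: "nat \<Rightarrow> nat" and D where c: "\<And>s. 0 < c s"
    "\<And>j. j \<le> Q \<Longrightarrow> int (\<Sum>s\<le>N. c s * ((N - s choose j) + (N - s choose (N - j)))) =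
       D + 2 * int (inv_into UNIV \<pi> (Suc j))"
    by (rule weights_with_prescribed_deviation[OF assms(2), of "\<lambda>j. int (inv_into UNIV \<pi> (Suc j))"])
      (rule that)
  define f where "f t k = (\<Sum>s\<le>N. c s * t ^ (N - s) * join_faces (Suc N) (Suc s) t k)" for t k
  \<comment> \<open>The coefficient of \<open>t ^ Suc N\<close> in the entry at \<open>k\<close>;
    the two binomials come from the faces of size \<open>N + 2 - k\<close> and \<open>k\<close>,
    respectively.\<close>
  define H where "H k = (\<Sum>s\<le>N. c s * ((N - s choose (k - 1)) + (N - s choose (Suc N - k))))" for k
  \<comment> \<open>\<open>t ^ N * K\<close> bounds the combined error of both sums, and
    \<open>t > K\<close> makes it smaller than \<open>t ^ Suc N\<close>. The choice
    \<open>K + 2\<close> also gives \<open>2 \<le> t\<close>.\<close>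
  define K where "K = 2 * (2 ^ Suc N * (\<Sum>s\<le>N. c s))"
  define t where "t = K + 2"
  have H: "int (H (\<pi> i)) = D + 2 * int i" if "i \<in> {1..Suc Q}" for i
  proof -
    have "\<pi> i \<in> {1..Suc Q}" using that permutes_in_image[OF assms(1)] by blast
    moreover from this have "\<pi> i - 1 \<le> Q" by auto
    ultimately show ?thesis
      using c(2)[of "\<pi> i - 1"] permutes_inverses(2)[OF assms(1)] by (simp add: H_def)
  qed
  have split: "H k = (\<Sum>s\<le>N. c s * (N - s choose (Suc N - k))) + (\<Sum>s\<le>N. c s * (N - s choose (Suc N - (N + 2 - k))))"
    if "k \<in> {1..Suc Q}" for k
  proof -
    have "Suc N - (N + 2 - k) = k - 1" using that assms(2) by auto
    then show ?thesis by (simp add: H_def distrib_left sum.distrib)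
  qed
  have lower: "t ^ Suc N * H k \<le> f t k + f t (N + 2 - k)"
    and upper: "f t k + f t (N + 2 - k) \<le> t ^ Suc N * H k + t ^ N * K" if "k \<in> {1..Suc Q}" for k
  proof -
    have "k \<le> Suc N" "N + 2 - k \<le> Suc N" "0 < t" using that assms(2) by (auto simp: t_def)
    then show "t ^ Suc N * H k \<le> f t k + f t (N + 2 - k)"
      "f t k + f t (N + 2 - k) \<le> t ^ Suc N * H k + t ^ N * K"
      using weighted_join_faces_bounds[of k N t c] weighted_join_faces_bounds[of "N + 2 - k" N t c]
      unfolding f_def[symmetric] split[OF that] K_def distrib_left mult_2 by linarith+
  qed
  show ?thesis
  proof (rule that[of c t])
    show "0 < c s" for s by (rule c(1))
    show "2 \<le> t" by (simp add: t_def)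
    have "f t (\<pi> i) + f t (N + 2 - \<pi> i) < f t (\<pi> i') + f t (N + 2 - \<pi> i')"
      if i: "i \<in> {1..Suc Q}" "i' \<in> {1..Suc Q}" "i < i'" for i i'
    proof -
      have \<pi>: "\<pi> i \<in> {1..Suc Q}" "\<pi> i' \<in> {1..Suc Q}"
        using i(1,2) permutes_in_image[OF assms(1)] by blast+
      have "Suc (H (\<pi> i)) \<le> H (\<pi> i')"
        using H[OF i(1)] H[OF i(2)] i(3) by linarith
      then have le: "t ^ Suc N * Suc (H (\<pi> i)) \<le> t ^ Suc N * H (\<pi> i')"
        by (rule mult_left_mono) simp
      have "t ^ N * K < t ^ Suc N"
        by (simp add: t_def)
      then have "f t (\<pi> i) + f t (N + 2 - \<pi> i) < t ^ Suc N * Suc (H (\<pi> i))"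
        using upper[OF \<pi>(1)] unfolding mult_Suc_right by linarith
      also note le
      also note lower[OF \<pi>(2)]
      finally show ?thesis .
    qed
    then show "strict_mono_on {1..Suc Q} (\<lambda>i. (\<lambda>k. (\<Sum>s\<le>N. c s * t ^ (N - s) * join_faces (Suc N) (Suc s) t k) +
       (\<Sum>s\<le>N. c s * t ^ (N - s) * join_faces (Suc N) (Suc s) t (N + 2 - k))) (\<pi> i))"
      unfolding f_def by (intro strict_mono_onI) simp
  qed
qed

section \<open>Disjoint unions of joins of discrete sets\<close>

text \<open>A forbidden pair has two elements, so it lies in no singleton and every vertex is a
  face.\<close>

lemma simplicial_complex_on_flag:
  assumes "flag_complex_on m \<Delta>"
  shows "simplicial_complex_on m \<Delta>"
proof -
  obtain E where E: "E \<subseteq> {e. e \<subseteq> {1..m} \<and> card e = 2}" "\<Delta> = independence_complex m E"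
    using assms unfolding flag_complex_on_def by blast
  have "\<not> e \<subseteq> {i}" if "e \<in> E" for e i
  proof
    assume "e \<subseteq> {i}"
    then have "card e \<le> 1" using card_mono[of "{i}" e] by simp
    then show False using E(1) that by auto
  qed
  moreover have "\<not> e \<subseteq> {}" if "e \<in> E" for e
    using E(1) that by auto
  ultimately show ?thesis
    unfolding simplicial_complex_on_def E(2) independence_complex_def by blast
qed

text \<open>A vertex \<open>(c, l, x)\<close> is the element \<open>x\<close> of the part \<open>l\<close> of the component \<open>c\<close>.\<close>

definition compatible :: "'c \<times> nat \<times> nat \<Rightarrow> 'c \<times> nat \<times> nat \<Rightarrow> bool" where
  "compatible u v \<longleftrightarrow> fst u = fst v \<and> fst (snd u) \<noteq> fst (snd v)"

definition transversal :: "'c \<Rightarrow> nat set \<Rightarrow> (nat \<Rightarrow> nat) \<Rightarrow> ('c \<times> nat \<times> nat) set" where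
  "transversal c L f = (\<lambda>l. (c, l, f l)) ` L"

lemma card_transversal [simp]: "card (transversal c L f) = card L"
  unfolding transversal_def by (rule card_image) (simp add: inj_on_def)

lemma transversal_cong: "(\<And>l. l \<in> L \<Longrightarrow> f l = g l) \<Longrightarrow> transversal c L f = transversal c L g"
  unfolding transversal_def by (rule image_cong) simp_all

text \<open>Any point of a nonempty transversal reveals the component, whereas the empty one is
  shared by all components.\<close>

lemma transversal_eq_iff:
  assumes "L \<noteq> {}"
  shows "transversal c L f = transversal c' L' f' \<longleftrightarrow> c = c' \<and> L = L' \<and> (\<forall>l\<in>L. f l = f' l)"
proof
  assume eq: "transversal c L f = transversal c' L' f'"
  have mem: "(a, l, x) \<in> transversal b K g \<longleftrightarrow> a = b \<and> l \<in> K \<and> x = g l"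
    for a b :: 'a and l x K g
    unfolding transversal_def by auto
  have *: "a = c \<and> l \<in> L \<and> x = f l \<longleftrightarrow> a = c' \<and> l \<in> L' \<and> x = f' l" for a l x
    using eq mem by metis
  obtain l0 where "l0 \<in> L" using assms by blast
  then have "c = c'" using *[of c l0 "f l0"] by simp
  moreover have "L = L'" using * \<open>c = c'\<close> by blast
  ultimately show "c = c' \<and> L = L' \<and> (\<forall>l\<in>L. f l = f' l)" using * by blast
next
  assume "c = c' \<and> L = L' \<and> (\<forall>l\<in>L. f l = f' l)"
  then show "transversal c L f = transversal c' L' f'"
    using transversal_cong[of L f f' c] by simp
qed

text \<open>Indexing the components allows equal joins to be repeated. Nonempty parts ensure that
  every face extends to one with \<open>n\<close> vertices.\<close>

locale multipartite_union =
  fixes C :: "'c set" and sz :: "'c \<Rightarrow> nat \<Rightarrow> nat" and n :: nat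
  assumes finite_C: "finite C" and C_nonempty: "C \<noteq> {}"
    and sz_pos: "\<And>c l. c \<in> C \<Longrightarrow> l < n \<Longrightarrow> 0 < sz c l"
begin

definition V :: "('c \<times> nat \<times> nat) set" where
  "V = (SIGMA c:C. SIGMA l:{..<n}. {..<sz c l})"

definition faces :: "('c \<times> nat \<times> nat) set set" where
  "faces = {T. T \<subseteq> V \<and> pairwise compatible T}"

lemma finite_V: "finite V"
  unfolding V_def using finite_C by auto

lemma finite_faces: "finite faces"
  unfolding faces_def using finite_V by simp

lemma transversal_face:
  "c \<in> C \<Longrightarrow> L \<subseteq> {..<n} \<Longrightarrow> (\<And>l. l \<in> L \<Longrightarrow> f l < sz c l) \<Longrightarrow> transversal c L f \<in> faces"
  unfolding faces_def transversal_def V_def pairwise_def compatible_def by auto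

text \<open>Pairwise compatibility forces a common component and distinct parts, so a face is the
  graph of a function on the parts it meets.\<close>

lemma face_transversal:
  assumes "T \<in> faces"
  obtains c L f where "c \<in> C" "L \<subseteq> {..<n}" "\<And>l. l \<in> L \<Longrightarrow> f l < sz c l" "T = transversal c L f"
proof (cases "T = {}")
  case True
  obtain c where "c \<in> C" using C_nonempty by blast
  with True that[of c "{}"] show ?thesis by (simp add: transversal_def)
next
  case False
  then obtain u where u: "u \<in> T" by blast
  let ?c = "fst u" and ?L = "(\<lambda>v. fst (snd v)) ` T"
  have T: "T \<subseteq> V" "pairwise compatible T" using assms by (auto simp: faces_def)
  have c: "fst v = ?c" if "v \<in> T" for v
  proof (cases "v = u")
    case False
    then have "compatible v u" using T(2) u that by (simp add: pairwise_def)
    then show ?thesis by (simp add: compatible_def)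
  qed simp
  have inj: "v = w" if "v \<in> T" "w \<in> T" "fst (snd v) = fst (snd w)" for v w
  proof (rule ccontr)
    assume "v \<noteq> w"
    then have "compatible v w" using T(2) that(1,2) by (simp add: pairwise_def)
    then show False using that(3) by (simp add: compatible_def)
  qed
  define f where "f l = snd (snd (THE v. v \<in> T \<and> fst (snd v) = l))" for l
  have f: "f (fst (snd v)) = snd (snd v)" if "v \<in> T" for v
  proof -
    have "(THE w. w \<in> T \<and> fst (snd w) = fst (snd v)) = v"
      using that inj by (intro the_equality) auto
    then show ?thesis by (simp add: f_def)
  qed
  show ?thesis
  proof (rule that[of ?c ?L f])
    show "?c \<in> C" using u T(1) by (auto simp: V_def)
    show "?L \<subseteq> {..<n}" using T(1) by (auto simp: V_def)
    show "f l < sz ?c l" if l: "l \<in> ?L" for l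
    proof -
      obtain v where "v \<in> T" "l = fst (snd v)" using l by blast
      then show ?thesis using f[of v] c[of v] T(1) by (auto simp: V_def)
    qed
    have "v = (?c, fst (snd v), f (fst (snd v)))" if "v \<in> T" for v
      using c[OF that] f[OF that] by (cases v) auto
    then show "T = transversal ?c ?L f"
      unfolding transversal_def image_image by (force simp: image_iff)
  qed
qed

text \<open>A nonempty face determines its component, its parts and its choice of points. For
  \<open>k = 0\<close> the sum would count the empty face once per component.\<close>

lemma card_faces:
  assumes "0 < k"
  shows "card {T \<in> faces. card T = k} = (\<Sum>c\<in>C. \<Sum>L | L \<subseteq> {..<n} \<and> card L = k. \<Prod>l\<in>L. sz c l)"
proof -
  let ?D = "SIGMA c:C. SIGMA L:{L. L \<subseteq> {..<n} \<and> card L = k}. PiE L (\<lambda>l. {..<sz c l})"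
  have fin: "finite L" if "L \<subseteq> {..<n}" for L using that finite_subset by blast
  have "bij_betw (\<lambda>(c, L, f). transversal c L f) ?D {T \<in> faces. card T = k}"
    unfolding bij_betw_def
  proof
    show "inj_on (\<lambda>(c, L, f). transversal c L f) ?D"
    proof (rule inj_onI)
      fix p p' assume p: "p \<in> ?D" "p' \<in> ?D"
        and eq: "(\<lambda>(c, L, f). transversal c L f) p = (\<lambda>(c, L, f). transversal c L f) p'"
      obtain c L f c' L' f' where pp: "p = (c, L, f)" "p' = (c', L', f')"
        by (cases p, cases p') blast
      have f: "f \<in> PiE L (\<lambda>l. {..<sz c l})" "f' \<in> PiE L' (\<lambda>l. {..<sz c' l})" "card L = k"
        using p unfolding pp by auto
      have "L \<noteq> {}" using f(3) assms by auto
      with eq have cL: "c = c'" "L = L'" "\<forall>l\<in>L. f l = f' l"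
        unfolding pp by (simp_all add: transversal_eq_iff)
      then have "f = f'" using f by (intro PiE_ext[OF f(1), of f']) auto
      with cL show "p = p'" unfolding pp by simp
    qed
    show "(\<lambda>(c, L, f). transversal c L f) ` ?D = {T \<in> faces. card T = k}"
    proof safe
      fix c L f
      assume "c \<in> C" "L \<subseteq> {..<n}" "f \<in> PiE L (\<lambda>l. {..<sz c l})"
      then show "transversal c L f \<in> faces"
        by (intro transversal_face) (auto simp: PiE_iff)
      show "card (transversal c L f) = card L" by simp
    next
      fix T assume T: "T \<in> faces" "k = card T"
      from T(1) obtain c L f where cL: "c \<in> C" "L \<subseteq> {..<n}" "\<And>l. l \<in> L \<Longrightarrow> f l < sz c l" "T = transversal c L f"
        by (rule face_transversal) (rule that)
      have "T = transversal c L (restrict f L)"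
        unfolding cL(4) by (rule transversal_cong) simp
      moreover have "(c, L, restrict f L) \<in> (SIGMA c:C. SIGMA L:{L. L \<subseteq> {..<n} \<and> card L = card T}. PiE L (\<lambda>l. {..<sz c l}))"
        using cL by auto
      ultimately show "T \<in> (\<lambda>(c, L, f). transversal c L f) `
          (SIGMA c:C. SIGMA L:{L. L \<subseteq> {..<n} \<and> card L = card T}. PiE L (\<lambda>l. {..<sz c l}))"
        by (intro image_eqI[of _ _ "(c, L, restrict f L)"]) simp_all
    qed
  qed
  then have "card {T \<in> faces. card T = k} = card ?D"
    by (rule bij_betw_same_card[symmetric])
  also have "\<dots> = (\<Sum>c\<in>C. \<Sum>L | L \<subseteq> {..<n} \<and> card L = k. card (PiE L (\<lambda>l. {..<sz c l})))"
    using finite_C by (subst card_SigmaI) (auto intro!: sum.cong card_SigmaI finite_SigmaI finite_PiE fin)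
  also have "\<dots> = (\<Sum>c\<in>C. \<Sum>L | L \<subseteq> {..<n} \<and> card L = k. \<Prod>l\<in>L. sz c l)"
    by (intro sum.cong) (auto simp: card_PiE fin)
  finally show ?thesis .
qed

section \<open>Relabelling the vertices as 1, ..., m\<close>

definition m :: nat where "m = card V"

definition \<theta> :: "'c \<times> nat \<times> nat \<Rightarrow> nat" where
  "\<theta> = (SOME h. bij_betw h V {1..m})"

lemma bij_\<theta>: "bij_betw \<theta> V {1..m}"
  unfolding \<theta>_def
  by (rule someI_ex[of "\<lambda>h. bij_betw h V {1..m}"])
    (simp add: m_def finite_V finite_same_card_bij)

definition \<Delta> :: "nat set set" where
  "\<Delta> = (`) \<theta> ` faces"

lemma inj_image_\<theta>: "inj_on ((`) \<theta>) (Pow V)"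
  using bij_\<theta> unfolding bij_betw_def by (simp add: inj_on_image_Pow)

lemma card_image_\<theta>: "T \<subseteq> V \<Longrightarrow> card (\<theta> ` T) = card T"
  using bij_\<theta> unfolding bij_betw_def by (meson card_image inj_on_subset)

lemma faces_subset: "T \<in> faces \<Longrightarrow> T \<subseteq> V"
  by (simp add: faces_def)

text \<open>The forbidden pairs are the images of the incompatible pairs; avoiding them all is
  pairwise compatibility.\<close>

lemma flag_\<Delta>: "flag_complex_on m \<Delta>"
proof -
  let ?E = "{\<theta> ` {u, v} | u v. u \<in> V \<and> v \<in> V \<and> u \<noteq> v \<and> \<not> compatible u v}"
  have V: "\<theta> ` V = {1..m}" and inj: "inj_on \<theta> V" using bij_\<theta> unfolding bij_betw_def by auto
  have "?E \<subseteq> {e. e \<subseteq> {1..m} \<and> card e = 2}"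
  proof
    fix e assume "e \<in> ?E"
    then obtain u v where e: "e = \<theta> ` {u, v}" "u \<in> V" "v \<in> V" "u \<noteq> v" by blast
    then have "card e = 2"
      using card_image_\<theta>[of "{u, v}"] by simp
    moreover have "e \<subseteq> {1..m}"
      using e(2,3) V unfolding e(1) by blast
    ultimately show "e \<in> {e. e \<subseteq> {1..m} \<and> card e = 2}" by blast
  qed
  moreover have "\<Delta> = independence_complex m ?E"
  proof safe
    fix S assume "S \<in> \<Delta>"
    then obtain T where T: "T \<in> faces" "S = \<theta> ` T" unfolding \<Delta>_def by blast
    have "\<not> \<theta> ` {u, v} \<subseteq> S" if "u \<in> V" "v \<in> V" "u \<noteq> v" "\<not> compatible u v" for u v
    proof
      assume "\<theta> ` {u, v} \<subseteq> S"
      then have "u \<in> T" "v \<in> T"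
        using inj_on_image_mem_iff[OF inj] faces_subset[OF T(1)] that(1,2) unfolding T(2) by auto
      then show False using T(1) that(3,4) unfolding faces_def pairwise_def by blast
    qed
    then show "S \<in> independence_complex m ?E"
      using T faces_subset[OF T(1)] V unfolding independence_complex_def by blast
  next
    fix S assume S: "S \<in> independence_complex m ?E"
    then have "S \<subseteq> \<theta> ` V" unfolding V independence_complex_def by blast
    then obtain T where T: "T \<subseteq> V" "S = \<theta> ` T" by (meson subset_imageE)
    have "pairwise compatible T"
      unfolding pairwise_def
    proof (intro ballI impI, rule ccontr)
      fix u v assume "u \<in> T" "v \<in> T" "u \<noteq> v" "\<not> compatible u v"
      then have "\<theta> ` {u, v} \<in> ?E" "\<theta> ` {u, v} \<subseteq> S" using T by blast+
      then show False using S unfolding independence_complex_def by blast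
    qed
    then show "S \<in> \<Delta>" using T unfolding \<Delta>_def faces_def by blast
  qed
  ultimately show ?thesis unfolding flag_complex_on_def by blast
qed

lemma card_\<Delta>:
  assumes "0 < k"
  shows "card {S \<in> \<Delta>. card S = k} = (\<Sum>c\<in>C. \<Sum>L | L \<subseteq> {..<n} \<and> card L = k. \<Prod>l\<in>L. sz c l)"
proof -
  have "{S \<in> \<Delta>. card S = k} = (`) \<theta> ` {T \<in> faces. card T = k}"
    unfolding \<Delta>_def using card_image_\<theta> faces_subset by auto
  moreover have "inj_on ((`) \<theta>) {T \<in> faces. card T = k}"
    using inj_image_\<theta> by (rule inj_on_subset) (auto simp: faces_def)
  ultimately show ?thesis
    using card_faces[OF assms] by (simp add: card_image)
qed

lemma card_face_le: "T \<in> faces \<Longrightarrow> card T \<le> n"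
proof -
  assume "T \<in> faces"
  then obtain c L f where "L \<subseteq> {..<n}" "T = transversal c L f" by (rule face_transversal) (rule that)
  then show ?thesis using card_mono[of "{..<n}" L] by simp
qed

lemma card_facet_\<Delta>:
  assumes "S \<in> facets \<Delta>"
  shows "card S = n"
proof -
  from assms obtain T where T: "T \<in> faces" "S = \<theta> ` T"
    unfolding facets_def \<Delta>_def by blast
  from T(1) obtain c L f where cL: "c \<in> C" "L \<subseteq> {..<n}" "\<And>l. l \<in> L \<Longrightarrow> f l < sz c l" "T = transversal c L f"
    by (rule face_transversal) (rule that)
  \<comment> \<open>The missing parts are filled with the point 0, which exists because all parts
    are nonempty.\<close>
  let ?f = "\<lambda>l. if l \<in> L then f l else 0"
  let ?T = "transversal c {..<n} ?f"
  have "?T \<in> faces"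
    using cL sz_pos by (intro transversal_face) auto
  moreover have "T \<subseteq> ?T"
    using cL(2) unfolding cL(4) transversal_def by auto
  ultimately have "\<theta> ` ?T \<in> \<Delta>" "S \<subseteq> \<theta> ` ?T"
    unfolding \<Delta>_def T(2) by auto
  then have "S = \<theta> ` ?T" using assms unfolding facets_def by blast
  then show ?thesis using card_image_\<theta>[OF faces_subset[OF \<open>?T \<in> faces\<close>]] by simp
qed

text \<open>No face has more than \<open>n\<close> vertices, so a face containing this one cannot be
  larger.\<close>

lemma full_transversal_facet:
  assumes "c \<in> C" "\<And>l. l < n \<Longrightarrow> f l < sz c l"
  shows "\<theta> ` transversal c {..<n} f \<in> facets \<Delta>"
  unfolding facets_def
proof (intro CollectI conjI ballI impI)
  have face: "transversal c {..<n} f \<in> faces"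
    using assms by (intro transversal_face) auto
  then show "\<theta> ` transversal c {..<n} f \<in> \<Delta>" unfolding \<Delta>_def by blast
  fix S assume "S \<in> \<Delta>" and sub: "\<theta> ` transversal c {..<n} f \<subseteq> S"
  then obtain T where T: "T \<in> faces" "S = \<theta> ` T" unfolding \<Delta>_def by blast
  have "finite S" using T finite_subset[OF faces_subset finite_V] by simp
  moreover have "card S \<le> card (\<theta> ` transversal c {..<n} f)"
    using card_face_le[OF T(1)] card_image_\<theta>[OF faces_subset[OF T(1)]]
      card_image_\<theta>[OF faces_subset[OF face]] T(2) by simp
  ultimately show "\<theta> ` transversal c {..<n} f = S"
    using card_seteq[OF _ sub] by blast
qed

lemma prod_transversal:
  assumes "c \<in> C" "\<And>l. l < n \<Longrightarrow> f l < sz c l"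
  shows "(\<Prod>j\<in>\<theta> ` transversal c {..<n} f. h j) = (\<Prod>l<n. h (\<theta> (c, l, f l)))"
proof -
  have sub: "transversal c {..<n} f \<subseteq> V"
    using assms by (intro faces_subset transversal_face) auto
  then have "inj_on \<theta> (transversal c {..<n} f)"
    using bij_\<theta> unfolding bij_betw_def by (meson inj_on_subset)
  then have "(\<Prod>j\<in>\<theta> ` transversal c {..<n} f. h j) = (\<Prod>v\<in>transversal c {..<n} f. h (\<theta> v))"
    by (rule prod.reindex_cong) simp_all
  also have "\<dots> = (\<Prod>l<n. h (\<theta> (c, l, f l)))"
    unfolding transversal_def by (subst prod.reindex) (auto simp: inj_on_def)
  finally show ?thesis .
qed

text \<open>Swapping the choice in one of two parts with at least two elements gives four facets with
  \<open>u\<^sub>1 u\<^sub>2 = u\<^sub>3 u\<^sub>4\<close>.\<close>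

lemma alg_dep_facets:
  fixes Fc :: "nat \<Rightarrow> nat set"
  assumes bij: "bij_betw Fc {1..s} (facets \<Delta>)"
    and c: "c \<in> C" "2 \<le> n" "2 \<le> sz c 0" "2 \<le> sz c 1"
  shows "alg_dep_family {1..s} (\<lambda>i. \<Prod>j\<in>Fc i. Var (UVar j) :: (pvar, 'k::field) mpoly)"
proof -
  \<comment> \<open>The four facets take point \<open>x\<close> of part 0 and point \<open>y\<close>
    of part 1 for \<open>x, y < 2\<close> and agree elsewhere. The products of 00 with 11 and of 01
    with 10 then agree part by part.\<close>
  define f where "f x y l = (if l = 0 then x else if l = 1 then y else 0)" for x y l :: nat
  let ?T = "\<lambda>x y. transversal c {..<n} (f x y)"
  have f: "f x y l < sz c l" if "x < 2" "y < 2" "l < n" for x y l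
    using that c sz_pos[of c l] by (auto simp: f_def)
  have "\<exists>i\<in>{1..s}. Fc i = \<theta> ` ?T x y" if "x < 2" "y < 2" for x y
  proof -
    have "\<theta> ` ?T x y \<in> Fc ` {1..s}"
      using full_transversal_facet[OF c(1), of "f x y"] f[OF that] bij unfolding bij_betw_def by simp
    then show ?thesis by force
  qed
  then obtain i where i: "\<And>x y. x < 2 \<Longrightarrow> y < 2 \<Longrightarrow> i x y \<in> {1..s}"
    "\<And>x y. x < 2 \<Longrightarrow> y < 2 \<Longrightarrow> Fc (i x y) = \<theta> ` ?T x y"
    by metis
  have inj: "x = x' \<and> y = y'"
    if "x < 2" "y < 2" "x' < 2" "y' < 2" "i x y = i x' y'" for x y x' y'
  proof -
    have "\<theta> ` ?T x y = \<theta> ` ?T x' y'" using i(2)[OF that(1,2)] i(2)[OF that(3,4)] that(5) by simp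
    moreover have "?T a b \<in> Pow V" if "a < 2" "b < 2" for a b
      using faces_subset[OF transversal_face[OF c(1) order_refl, of "f a b"]] f[OF that] by simp
    then have "?T x y \<in> Pow V" "?T x' y' \<in> Pow V" using that(1-4) by blast+
    ultimately have "?T x y = ?T x' y'" using inj_onD[OF inj_image_\<theta>] by blast
    then have "\<forall>l<n. f x y l = f x' y' l"
      using c(2) by (subst (asm) transversal_eq_iff) (auto simp: lessThan_empty_iff)
    then have "f x y 0 = f x' y' 0" "f x y 1 = f x' y' 1" using c(2) by auto
    then show ?thesis by (simp add: f_def)
  qed
  let ?g = "\<lambda>i. \<Prod>j\<in>Fc i. Var (UVar j) :: (pvar, 'k) mpoly"
  let ?G = "\<lambda>x y. \<Prod>l<n. Var (UVar (\<theta> (c, l, f x y l))) :: (pvar, 'k) mpoly"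
  have g: "?g (i x y) = ?G x y" if "x < 2" "y < 2" for x y
    unfolding i(2)[OF that] by (rule prod_transversal[OF c(1)]) (rule f[OF that])
  have "?g (i 0 0) * ?g (i 1 1) = ?G 0 0 * ?G 1 1"
    by (subst (1 2) g) simp_all
  also have "\<dots> = ?G 0 1 * ?G 1 0"
    unfolding prod.distrib[symmetric] by (rule prod.cong) (auto simp: f_def mult.commute)
  also have "\<dots> = ?g (i 0 1) * ?g (i 1 0)"
    by (subst (1 2) g) simp_all
  finally have "?g (i 0 0) * ?g (i 1 1) = ?g (i 0 1) * ?g (i 1 0)" .
  then show ?thesis
  proof (rule alg_dep_of_product_relation[rotated 2])
    show "{i 0 0, i 1 1, i 0 1, i 1 0} \<subseteq> {1..s}"
      using i(1)[of 0 0] i(1)[of 1 1] i(1)[of 0 1] i(1)[of 1 0] by simp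
    show "distinct [i 0 0, i 1 1, i 0 1, i 1 0]"
      using inj[of 0 0 1 1] inj[of 0 0 0 1] inj[of 0 0 1 0] inj[of 1 1 0 1] inj[of 1 1 1 0] inj[of 0 1 1 0]
      by auto
  qed
qed

end

section \<open>Unconstrained first halves\<close>

lemma first_halves_mono:
  "(\<And>s m F. P s m F \<Longrightarrow> P' s m F) \<Longrightarrow> first_halves P d \<subseteq> first_halves P' d"
  unfolding first_halves_def by blast

lemma unconstrained_mono: "unconstrained q H \<Longrightarrow> H \<subseteq> H' \<Longrightarrow> unconstrained q H'"
  unfolding unconstrained_def by blast

text \<open>The complex without vertices has the empty set as its only facet and the form
  \<open>x\<^sub>1\<close>. The coefficient 1 is linearly independent and satisfies the relation
  \<open>X - 1 = 0\<close>.\<close>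

lemma first_halves_1_nonempty:
  "first_halves (flag_simplicial_perazzo_form :: nat \<Rightarrow> nat \<Rightarrow> (pvar, 'k::field) mpoly \<Rightarrow> bool) 1 \<noteq> {}"
proof -
  let ?\<Delta> = "{{}} :: nat set set" and ?Fc = "\<lambda>_ :: nat. {} :: nat set"
  have flag: "flag_complex_on 0 ?\<Delta>"
    unfolding flag_complex_on_def independence_complex_def by (intro exI[of _ "{}"]) auto
  interpret facet_enumeration 1 0 0 ?\<Delta> ?Fc
    by unfold_locales
      (auto simp: simplicial_complex_on_flag[OF flag] facets_def bij_betw_def)
  let ?F = "simplicial_form 1 ?Fc :: (pvar, 'k) mpoly"
  have "alg_dep_family {1..1} (\<lambda>i. \<Prod>j\<in>?Fc i. Var (UVar j) :: (pvar, 'k) mpoly)"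
  proof (rule alg_dep_binomial)
    show "Poly_Mapping.single 1 1 \<noteq> (0 :: nat \<Rightarrow>\<^sub>0 nat)"
      by (metis lookup_single_eq lookup_zero one_neq_zero)
  qed simp_all
  then have "flag_simplicial_perazzo_form 1 0 ?F"
    unfolding flag_simplicial_perazzo_form_def
    using perazzo_form_simplicial_form form_of_complex_simplicial_form flag by blast
  moreover have "socle_degree (perazzo_vars 1 0) ?F = 1"
    using socle_degree_simplicial_form by simp
  ultimately show ?thesis
    unfolding first_halves_def by blast
qed

lemma unconstrained_flag:
  assumes "3 \<le> d"
  shows "unconstrained (d div 2)
    (first_halves (flag_simplicial_perazzo_form :: nat \<Rightarrow> nat \<Rightarrow> (pvar, 'k::field) mpoly \<Rightarrow> bool) d)"
  unfolding unconstrained_def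
proof (intro allI impI)
  fix \<pi> assume "\<pi> permutes {1..d div 2}"
  \<comment> \<open>The facets will have \<open>d - 1 = Suc N\<close> vertices, and the positions
    \<open>1, ..., Suc Q\<close> form the first half.\<close>
  define N Q where "N = d - 2" and "Q = d div 2 - 1"
  have d: "d = Suc (Suc N)" "1 \<le> N" "2 * Q \<le> N" and Q: "d div 2 = Suc Q"
    using assms unfolding N_def Q_def by auto
  have \<pi>: "\<pi> permutes {1..Suc Q}" using \<open>\<pi> permutes {1..d div 2}\<close> Q by simp
  obtain w :: "nat \<Rightarrow> nat" and t where w: "\<And>s. 0 < w s" and t: "2 \<le> t"
    and mono: "strict_mono_on {1..Suc Q} (\<lambda>i. (\<lambda>k. (\<Sum>s\<le>N. w s * t ^ (N - s) * join_faces (Suc N) (Suc s) t k) +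
       (\<Sum>s\<le>N. w s * t ^ (N - s) * join_faces (Suc N) (Suc s) t (N + 2 - k))) (\<pi> i))"
    by (rule unconstrained_weighted_join_faces[OF \<pi> d(3)]) (rule that)
  \<comment> \<open>The component \<open>(s, y)\<close> is copy number \<open>y\<close> of the join
    with \<open>Suc s\<close> parts of \<open>t\<close> points.\<close>
  define C where "C = (SIGMA s:{..N}. {..<w s * t ^ (N - s)})"
  define sz :: "nat \<times> nat \<Rightarrow> nat \<Rightarrow> nat" where "sz c l = (if l \<le> fst c then t else 1)" for c l
  \<comment> \<open>All parts of this component have \<open>t \<ge> 2\<close> points, and there are
    at least two parts as \<open>1 \<le> N\<close>; it supplies the algebraic relation.\<close>
  have C0: "(N, 0) \<in> C" unfolding C_def using w by simp
  interpret multipartite_union C sz "Suc N"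
  proof
    show "C \<noteq> {}" using C0 by blast
  qed (use t in \<open>auto simp: C_def sz_def\<close>)
  have count: "card {S \<in> \<Delta>. card S = k} = (\<Sum>s\<le>N. w s * t ^ (N - s) * join_faces (Suc N) (Suc s) t k)"
    if "0 < k" for k
  proof -
    have prod: "(\<Prod>l\<in>L. sz c l) = t ^ card (L \<inter> {..<Suc (fst c)})" if "L \<subseteq> {..<Suc N}" for c L
    proof -
      have "(\<Prod>l\<in>L. sz c l) = (\<Prod>l\<in>L. if l \<in> {..<Suc (fst c)} then t else 1)"
        unfolding sz_def by (intro prod.cong) auto
      also have "\<dots> = t ^ card (L \<inter> {..<Suc (fst c)})"
        unfolding prod.inter_restrict[OF finite_subset[OF that finite_lessThan], symmetric] by simp
      finally show ?thesis .
    qed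
    have "card {S \<in> \<Delta>. card S = k} = (\<Sum>c\<in>C. join_faces (Suc N) (Suc (fst c)) t k)"
      unfolding card_\<Delta>[OF that] join_faces_def by (intro sum.cong refl) (auto simp: prod)
    also have "\<dots> = (\<Sum>s\<le>N. \<Sum>y<w s * t ^ (N - s). join_faces (Suc N) (Suc s) t k)"
      unfolding C_def by (subst sum.Sigma) (simp_all add: case_prod_unfold)
    finally show ?thesis by simp
  qed
  obtain s and Fc :: "nat \<Rightarrow> nat set" where Fc: "bij_betw Fc {1..s} (facets \<Delta>)"
  proof -
    have "finite (facets \<Delta>)"
      unfolding facets_def \<Delta>_def using finite_faces by simp
    from ex_bij_betw_nat_finite_1[OF this] show ?thesis using that by blast
  qed
  interpret facet_enumeration s m "Suc N" \<Delta> Fc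
    using simplicial_complex_on_flag[OF flag_\<Delta>] card_facet_\<Delta> Fc by unfold_locales
  let ?F = "simplicial_form s Fc :: (pvar, 'k) mpoly"
  have "flag_simplicial_perazzo_form s m ?F"
    unfolding flag_simplicial_perazzo_form_def
    using perazzo_form_simplicial_form[OF alg_dep_facets[OF Fc C0]] form_of_complex_simplicial_form flag_\<Delta> t d(2)
    by (auto simp: sz_def)
  moreover have "socle_degree (perazzo_vars s m) ?F = d"
    using socle_degree_simplicial_form d(1) by simp
  ultimately have mem: "restrict (hilbert_function (perazzo_vars s m) ?F) {1..d div 2}
      \<in> first_halves (flag_simplicial_perazzo_form :: nat \<Rightarrow> nat \<Rightarrow> (pvar, 'k) mpoly \<Rightarrow> bool) d"
    unfolding first_halves_def by blast
  have hilb: "hilbert_function (perazzo_vars s m) ?F k =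
      (\<Sum>s\<le>N. w s * t ^ (N - s) * join_faces (Suc N) (Suc s) t k) +
      (\<Sum>s\<le>N. w s * t ^ (N - s) * join_faces (Suc N) (Suc s) t (N + 2 - k))"
    if "k \<in> {1..Suc Q}" for k
  proof -
    \<comment> \<open>Both face sizes \<open>k\<close> and \<open>d - k\<close> are positive, as
      \<open>count\<close> requires.\<close>
    have "0 < k" "k \<le> Suc (Suc N)" "0 < Suc (Suc N) - k" using that d(3) by auto
    then show ?thesis
      using hilbert_function_simplicial_form[where 'k = 'k, of k] by (simp add: num_faces_def count)
  qed
  have "strict_mono_on {1..d div 2} (\<lambda>i. restrict (hilbert_function (perazzo_vars s m) ?F) {1..d div 2} (\<pi> i))"
  proof (rule strict_mono_onI)
    fix i j assume ij: "i \<in> {1..d div 2}" "j \<in> {1..d div 2}" "i < j"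
    then have "\<pi> i \<in> {1..Suc Q}" "\<pi> j \<in> {1..Suc Q}"
      using permutes_in_image[OF \<pi>] unfolding Q by blast+
    then show "restrict (hilbert_function (perazzo_vars s m) ?F) {1..d div 2} (\<pi> i) <
        restrict (hilbert_function (perazzo_vars s m) ?F) {1..d div 2} (\<pi> j)"
      using strict_mono_onD[OF mono, of i j] ij hilb unfolding Q by simp
  qed
  with mem show "\<exists>a\<in>first_halves (flag_simplicial_perazzo_form :: nat \<Rightarrow> nat \<Rightarrow> (pvar, 'k) mpoly \<Rightarrow> bool) d.
      strict_mono_on {1..d div 2} (\<lambda>i. a (\<pi> i))"
    by blast
qed

theorem theorem5p7:
  fixes d :: nat
  assumes "d \<ge> 1" and "d \<noteq> 2"
  shows "unconstrained (d div 2)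
           (first_halves (flag_simplicial_perazzo_form ::
              nat \<Rightarrow> nat \<Rightarrow> (pvar, 'k::field_char_0) mpoly \<Rightarrow> bool) d) \<and>
         unconstrained (d div 2)
           (first_halves (simplicial_perazzo_form ::
              nat \<Rightarrow> nat \<Rightarrow> (pvar, 'k) mpoly \<Rightarrow> bool) d) \<and>
         unconstrained (d div 2)
           (first_halves (perazzo_form ::
              nat \<Rightarrow> nat \<Rightarrow> (pvar, 'k) mpoly \<Rightarrow> bool) d)"
proof -
  have "unconstrained (d div 2) (first_halves (flag_simplicial_perazzo_form ::
      nat \<Rightarrow> nat \<Rightarrow> (pvar, 'k) mpoly \<Rightarrow> bool) d)"
  proof (cases "d = 1")
    case True
    \<comment> \<open>The sequences have length 0 and the order condition is vacuous, so a nonempty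
      collection suffices.\<close>
    then show ?thesis
      using first_halves_1_nonempty[where 'k = 'k] by (auto simp: unconstrained_def strict_mono_on_def)
  next
    case False
    with assms show ?thesis by (intro unconstrained_flag) simp
  qed
  moreover have "first_halves (flag_simplicial_perazzo_form ::
      nat \<Rightarrow> nat \<Rightarrow> (pvar, 'k) mpoly \<Rightarrow> bool) d \<subseteq>
      first_halves (simplicial_perazzo_form :: nat \<Rightarrow> nat \<Rightarrow> (pvar, 'k) mpoly \<Rightarrow> bool) d"
    by (rule first_halves_mono) (auto simp: flag_simplicial_perazzo_form_def simplicial_perazzo_form_def)
  moreover have "first_halves (simplicial_perazzo_form ::
      nat \<Rightarrow> nat \<Rightarrow> (pvar, 'k) mpoly \<Rightarrow> bool) d \<subseteq>
      first_halves (perazzo_form :: nat \<Rightarrow> nat \<Rightarrow> (pvar, 'k) mpoly \<Rightarrow> bool) d"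
    by (rule first_halves_mono) (auto simp: simplicial_perazzo_form_def)
  ultimately show ?thesis
    by (meson unconstrained_mono)
qed

end
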